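(* Let $0<a<\infty$, let $k(z)$ be analytic in the interval $[0,a]$ with $k(0)\neq0$, and let $n$ be a positive integer. Then for all non-integer $\lambda\in\mathbb{C}$ in the half-plane $\mathrm{Re}(\lambda)\ge 1$, $$\mathrm{f.p.}\!\int_0^a\frac{k(t)\ln^n t}{t^{\lambda}}\,dt=\sum_{j=0}^{n}\binom{n}{j}(2\pi i)^{n-j}\,\beta_j(\lambda)\int_C\frac{k(z)}{z^{\lambda}}\ln^{j}z\,dz,$$ where $$\beta_j(\lambda)=\sum_{l=0}^{n-j}(-1)^l\,l!\;\mathbf{S}^{n-j}_l\;\frac{e^{-2\pi i\lambda l}}{(e^{-2\pi i\lambda}-1)^{l+1}}$$ and $\mathbf{S}^{n-j}_l$ is the Stirling number of the second kind.
   Context: Analytic in $[0,a]$ means that $k$ has a complex extension analytic in an open neighbourhood of $[0,a]$ in $\mathbb{C}$. Finite-part integral (written f.p. here; the paper uses a double-slashed integral sign): for $0<\epsilon<a$ write $\int_\epsilon^a k(t)t^{-\lambda}\ln^n t\,dt=C_\epsilon+D_\epsilon$, where $C_\epsilon$ converges and $D_\epsilon$ collects the diverging terms as $\epsilon\to0^+$, i.e. $D_\epsilon$ is a finite linear combination of functions $\epsilon^{-\mu}\ln^m\epsilon$ with $\mathrm{Re}\,\mu\ge0$, $m\in\mathbb{N}_0$, $(\mu,m)\ne(0,0)$. Then $\mathrm{f.p.}\int_0^a k(t)t^{-\lambda}\ln^n t\,dt:=\lim_{\epsilon\to0^+}C_\epsilon$. Branches: $\ln z=\ln|z|+i\arg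 z$ with $0\le\arg z<2\pi$, branch cut along the positive real axis, and $z^{\lambda}=e^{\lambda\ln z}$; on the upper side of the cut $\ln z=\ln t$, on the lower side the limiting value is $\ln z=\ln t+2\pi i$. Contour $C$: it starts at $a$ on the upper side of the branch cut, goes once counterclockwise around the origin, straddling the cut $[0,a]$, and ends at $a$ on the lower side of the cut. It lies in the region where $k$ is analytic, encloses no pole of $k(z)$ and crosses no branch cut of $k(z)$. Stirling convention: $\mathbf{S}^m_l$ is the number of partitions of an $m$-element set into $l$ non-empty blocks; $\mathbf{S}^0_0=1$, $\mathbf{S}^m_0=0$ for $m\ge1$.
   Formalization: The contour is required to enclose no singularity of k at all (k is analytic at every enclosed point), not merely no pole; if an essential singularity or a whole branch cut of k is enclosed, the formula fails in general. *)

theory Defs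
  imports "HOL-Complex_Analysis.Complex_Analysis" "HOL-Combinatorics.Stirling"
begin

text \<open>
  A finite linear combination of the terms $\epsilon^{-\mu} \ln^m \epsilon$ that have no limit
  for $\epsilon \to 0^+$. Purely imaginary $\mu \neq 0$ (bounded oscillating terms) are included.
\<close>

definition diverging_part :: "(real \<Rightarrow> complex) \<Rightarrow> bool" where
  "diverging_part D \<longleftrightarrow>
     (\<exists>(S :: (complex \<times> nat) set) (c :: complex \<times> nat \<Rightarrow> complex).
        finite S \<and> (\<forall>(\<mu>, m)\<in>S. Re \<mu> \<ge> 0 \<and> (\<mu>, m) \<noteq> (0, 0)) \<and>
        (\<forall>\<epsilon>>0. D \<epsilon> = (\<Sum>(\<mu>, m)\<in>S. c (\<mu>, m) * of_real \<epsilon> powr (- \<mu>) * of_real (ln \<epsilon>) ^ m)))"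

definition has_finite_part_integral :: "(real \<Rightarrow> complex) \<Rightarrow> complex \<Rightarrow> real \<Rightarrow> bool" where
  "has_finite_part_integral f I a \<longleftrightarrow>
     (\<exists>C D. (\<forall>\<epsilon>. 0 < \<epsilon> \<and> \<epsilon> < a \<longrightarrow> (f has_integral (C \<epsilon> + D \<epsilon>)) {\<epsilon>..a}) \<and>
            diverging_part D \<and> (C \<longlongrightarrow> I) (at_right 0))"

definition ln_cut :: "complex \<Rightarrow> complex" where
  "ln_cut z = of_real (ln (norm z)) + \<i> * of_real (Arg2pi z)"

definition powr_cut :: "complex \<Rightarrow> complex \<Rightarrow> complex" where
  "powr_cut z lam = exp (lam * ln_cut z)"

text \<open>
  The region where \<open>k\<close> is analytic is \<open>{z. k analytic_on {z}}\<close>. The points enclosed by the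
  contour are those with nonzero winding number; none of them may be a singularity of \<open>k\<close>,
  on a branch cut or otherwise. Apart from its two endpoints, the contour avoids the cut
  \<open>[0,\<infinity>)\<close> of the logarithm, so the boundary values that \<open>ln_cut\<close> takes on
  that cut do not affect the contour integrals.
\<close>

definition cut_contour :: "(complex \<Rightarrow> complex) \<Rightarrow> real \<Rightarrow> (real \<Rightarrow> complex) \<Rightarrow> bool" where
  "cut_contour k a \<gamma> \<longleftrightarrow>
     valid_path \<gamma> \<and> pathstart \<gamma> = of_real a \<and> pathfinish \<gamma> = of_real a \<and>
     (\<forall>t\<in>{0<..<1}. \<gamma> t \<notin> complex_of_real ` {0..}) \<and>
     (\<forall>\<^sub>F t in at_right 0. Im (\<gamma> t) > 0) \<and>
     (\<forall>\<^sub>F t in at_left 1. Im (\<gamma> t) < 0) \<and>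
     winding_number \<gamma> 0 = 1 \<and>
     (\<forall>z\<in>path_image \<gamma>. k analytic_on {z}) \<and>
     (\<forall>z. z \<notin> path_image \<gamma> \<and> winding_number \<gamma> z \<noteq> 0 \<longrightarrow> k analytic_on {z})"

definition beta_coeff :: "nat \<Rightarrow> nat \<Rightarrow> complex \<Rightarrow> complex" where
  "beta_coeff n j lam =
     (\<Sum>l=0..n - j. (- 1) ^ l * fact l * of_nat (Stirling (n - j) l) *
        (exp (- 2 * pi * \<i> * lam * of_nat l) / (exp (- 2 * pi * \<i> * lam) - 1) ^ (l + 1)))"

text \<open>
  Uniqueness of the finite part. In the variable $y = \ln\epsilon$ a diverging part becomes an
  exponential polynomial; the differences $F(y + h) - e^{-\mu_0 h} F(y)$ lower the degree of the
  coefficient of $e^{-\mu_0 y}$.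
\<close>

definition psize :: "complex poly \<Rightarrow> nat" where
  "psize p = (if p = 0 then 0 else Suc (degree p))"

definition pshift :: "complex \<Rightarrow> complex poly \<Rightarrow> complex poly" where
  "pshift h p = pcompose p [:h, 1:]"

lemma degree_pshift [simp]: "degree (pshift h p) = degree p"
  by (simp add: pshift_def degree_pcompose)

lemma poly_pshift [simp]: "poly (pshift h p) y = poly p (y + h)"
  by (simp add: pshift_def poly_pcompose add.commute)

lemma lead_coeff_pshift [simp]: "coeff (pshift h p) (degree p) = lead_coeff p"
  using lead_coeff_comp[of "[:h,1:]" p] by (simp add: pshift_def degree_pcompose)

lemma psize_0_iff [simp]: "psize p = 0 \<longleftrightarrow> p = 0"
  by (simp add: psize_def)

lemma psize_le: "degree q \<le> degree p \<Longrightarrow> p \<noteq> 0 \<Longrightarrow> psize q \<le> psize p"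
  by (simp add: psize_def)

lemma psize_diff:
  assumes "p \<noteq> 0"
  shows "psize (smult u (pshift h p - p)) < psize p"
proof (cases "pshift h p - p = 0")
  case False
  have "degree (pshift h p - p) \<le> degree p"
    by (metis degree_diff_le_max degree_pshift max.idem)
  moreover have "coeff (pshift h p - p) (degree p) = 0"
    by simp
  ultimately have "degree (pshift h p - p) < degree p"
    using False by (metis leading_coeff_0_iff le_neq_implies_less)
  then show ?thesis
    using assms by (auto simp: psize_def)
qed (use assms in \<open>simp add: psize_def\<close>)

lemma exp_poly_tendsto_0:
  fixes p :: "complex \<Rightarrow> complex poly"
  assumes "finite M" "\<And>\<mu>. \<mu> \<in> M \<Longrightarrow> Re \<mu> \<ge> 0"
    and "((\<lambda>y::real. \<Sum>\<mu>\<in>M. poly (p \<mu>) (of_real y) * exp (- \<mu> * of_real y)) \<longlongrightarrow> 0) at_bot"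
  shows "\<forall>\<mu>\<in>M. p \<mu> = 0"
  using assms(3)
proof (induction "\<Sum>\<mu>\<in>M. psize (p \<mu>)" arbitrary: p rule: less_induct)
  case (less p)
  define F where "F = (\<lambda>y::real. \<Sum>\<mu>\<in>M. poly (p \<mu>) (of_real y) * exp (- \<mu> * of_real y))"
  have F0: "(F \<longlongrightarrow> 0) at_bot" using less.prems unfolding F_def .
  show ?case
  proof (rule ccontr)
    assume "\<not> ?thesis"
    then obtain \<mu>0 where \<mu>0: "\<mu>0 \<in> M" "p \<mu>0 \<noteq> 0" by blast
    define h :: real where "h = 1 / (1 + (\<Sum>\<mu>\<in>M. norm (\<mu> - \<mu>0)))"
    have pos: "1 + (\<Sum>\<mu>\<in>M. norm (\<mu> - \<mu>0)) > 0"
      by (intro add_pos_nonneg sum_nonneg) auto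
    have h: "h > 0" unfolding h_def using pos by simp
    have ne: "exp (- \<mu> * h) \<noteq> exp (- \<mu>0 * h)" if "\<mu> \<in> M" "\<mu> \<noteq> \<mu>0" for \<mu> :: complex
    proof
      assume "exp (- \<mu> * h) = exp (- \<mu>0 * h)"
      then obtain n :: int where n: "- \<mu> * h = - \<mu>0 * h + (of_int (2 * n) * pi) * \<i>"
        unfolding exp_eq by blast
      then have e: "(\<mu>0 - \<mu>) * h = (of_int (2 * n) * pi) * \<i>"
        by (simp add: algebra_simps)
      have "norm ((\<mu>0 - \<mu>) * h) = norm (\<mu> - \<mu>0) * h"
        using h by (simp add: norm_mult norm_minus_commute)
      also have "\<dots> < 1"
      proof -
        have "norm (\<mu> - \<mu>0) \<le> (\<Sum>\<mu>\<in>M. norm (\<mu> - \<mu>0))"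
          using that assms(1) by (intro member_le_sum) auto
        then show ?thesis unfolding h_def using pos by (simp add: field_simps)
      qed
      finally have "\<bar>2 * real_of_int n * pi\<bar> < 1"
        unfolding e by (simp add: norm_mult abs_mult)
      then have small: "2 * \<bar>real_of_int n\<bar> * pi < 1" by (simp add: abs_mult)
      have "n = 0"
      proof (rule ccontr)
        assume "n \<noteq> 0"
        then have "1 \<le> \<bar>real_of_int n\<bar>" by linarith
        then have "2 * 1 * pi \<le> 2 * \<bar>real_of_int n\<bar> * pi"
          by (intro mult_right_mono) auto
        then show False using small pi_gt3 by linarith
      qed
      then show False using e h that by simp
    qed
    define q where "q = (\<lambda>\<mu>::complex. smult (exp (- \<mu> * h)) (pshift h (p \<mu>)) - smult (exp (- \<mu>0 * h)) (p \<mu>))"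
    have shift: "((\<lambda>y. F (y + h)) \<longlongrightarrow> 0) at_bot"
      by (rule filterlim_compose[OF F0]) (auto simp: filterlim_at_bot eventually_at_bot_linorder
          intro!: exI[of _ "_ - h"] simp: algebra_simps)
    have "((\<lambda>y. F (y + h) - exp (- \<mu>0 * h) * F y) \<longlongrightarrow> 0 - exp (- \<mu>0 * h) * 0) at_bot"
      by (intro tendsto_intros shift F0)
    moreover have "F (y + h) - exp (- \<mu>0 * h) * F y =
        (\<Sum>\<mu>\<in>M. poly (q \<mu>) (of_real y) * exp (- \<mu> * of_real y))" for y
      unfolding F_def sum_distrib_left sum_subtractf[symmetric] q_def
      by (intro sum.cong) (auto simp: algebra_simps exp_add exp_diff exp_minus divide_inverse)
    ultimately have lim: "((\<lambda>y::real. \<Sum>\<mu>\<in>M. poly (q \<mu>) (of_real y) * exp (- \<mu> * of_real y)) \<longlongrightarrow> 0) at_bot"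
      by simp
    have q0: "q \<mu>0 = smult (exp (- \<mu>0 * h)) (pshift h (p \<mu>0) - p \<mu>0)"
      by (simp add: q_def smult_diff_right)
    have le: "psize (q \<mu>) \<le> psize (p \<mu>)" for \<mu>
    proof (cases "p \<mu> = 0")
      case True
      then show ?thesis by (simp add: q_def psize_def pshift_def)
    next
      case False
      have "degree (q \<mu>) \<le> degree (p \<mu>)"
        unfolding q_def by (intro degree_diff_le) (auto intro: order.trans[OF degree_smult_le])
      then show ?thesis using False by (rule psize_le)
    qed
    have "(\<Sum>\<mu>\<in>M. psize (q \<mu>)) < (\<Sum>\<mu>\<in>M. psize (p \<mu>))"
      using \<mu>0 assms(1) le psize_diff[OF \<mu>0(2)] q0
      by (intro sum_strict_mono_ex1) (auto intro!: bexI[of _ \<mu>0])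
    then have q_zero: "\<forall>\<mu>\<in>M. q \<mu> = 0" using less.hyps lim by blast
    have others: "p \<mu> = 0" if "\<mu> \<in> M" "\<mu> \<noteq> \<mu>0" for \<mu> :: complex
    proof -
      have "coeff (q \<mu>) (degree (p \<mu>)) = (exp (- \<mu> * h) - exp (- \<mu>0 * h)) * lead_coeff (p \<mu>)"
        by (simp add: q_def algebra_simps)
      then show ?thesis using q_zero that ne[OF that] by simp
    qed
    have "pshift h (p \<mu>0) = p \<mu>0" using q0 q_zero \<mu>0 by simp
    then have step: "poly (p \<mu>0) (y + of_real h) = poly (p \<mu>0) y" for y :: complex
      by (metis poly_pshift)
    have "poly (p \<mu>0) (of_nat k * of_real h) = poly (p \<mu>0) 0" for k :: nat
      by (induction k) (use step in \<open>auto simp: distrib_right add.commute[of "of_real h"]\<close>)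
    then have "range (\<lambda>k::nat. of_nat k * complex_of_real h) \<subseteq> {x. poly (p \<mu>0 - [:poly (p \<mu>0) 0:]) x = 0}"
      by auto
    moreover have "infinite (range (\<lambda>k::nat. of_nat k * complex_of_real h))"
      using h by (intro range_inj_infinite) (auto simp: inj_def)
    ultimately have "p \<mu>0 - [:poly (p \<mu>0) 0:] = 0"
      using poly_roots_finite finite_subset by blast
    then obtain c where c: "p \<mu>0 = [:c:]" by (metis eq_iff_diff_eq_0)
    then have c0: "c \<noteq> 0" using \<mu>0 by auto
    have "F y = c * exp (- \<mu>0 * of_real y)" for y
    proof -
      have "F y = (\<Sum>\<mu>\<in>{\<mu>0}. poly (p \<mu>) (of_real y) * exp (- \<mu> * of_real y))"
        unfolding F_def using assms(1) \<mu>0 others by (intro sum.mono_neutral_right) auto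
      then show ?thesis using c by simp
    qed
    then have "((\<lambda>y::real. norm (c * exp (- \<mu>0 * of_real y))) \<longlongrightarrow> 0) at_bot"
      using F0 tendsto_norm_zero by (metis (no_types, lifting) ext)
    moreover have "\<forall>\<^sub>F y::real in at_bot. norm c \<le> norm (c * exp (- \<mu>0 * of_real y))"
      using eventually_le_at_bot[of 0]
    proof eventually_elim
      case (elim y)
      have "0 \<le> - (Re \<mu>0 * y)" using elim assms(2)[OF \<mu>0(1)] by (simp add: mult_nonneg_nonpos)
      then show ?case by (simp add: norm_mult norm_exp_eq_Re mult_le_cancel_left1)
    qed
    ultimately have "norm c \<le> 0"
      by (intro tendsto_le[OF _ _ tendsto_const]) auto
    then show False using c0 by simp
  qed
qed

lemma diverging_partE:
  assumes "diverging_part D"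
  obtains S c where "finite S" "\<And>\<mu> m. (\<mu>, m) \<in> S \<Longrightarrow> Re \<mu> \<ge> 0 \<and> (\<mu>, m) \<noteq> (0, 0)"
    "\<And>\<epsilon>. \<epsilon> > 0 \<Longrightarrow> D \<epsilon> = (\<Sum>(\<mu>, m)\<in>S. c (\<mu>, m) * of_real \<epsilon> powr (- \<mu>) * of_real (ln \<epsilon>) ^ m)"
proof -
  obtain S c where S: "finite S" "\<forall>(\<mu>, m)\<in>S. Re \<mu> \<ge> 0 \<and> (\<mu>, m) \<noteq> (0, 0)"
    "\<forall>\<epsilon>>0. D \<epsilon> = (\<Sum>(\<mu>, m)\<in>S. c (\<mu>, m) * of_real \<epsilon> powr (- \<mu>) * of_real (ln \<epsilon>) ^ m)"
    using assms unfolding diverging_part_def by blast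
  show thesis
    by (rule that[of S c]) (use S in \<open>blast, blast, blast\<close>)
qed

lemma diverging_part_tendsto:
  assumes D1: "diverging_part D1" and D2: "diverging_part D2"
    and lim: "((\<lambda>\<epsilon>. D1 \<epsilon> - D2 \<epsilon>) \<longlongrightarrow> L) (at_right 0)"
  shows "L = 0"
proof -
  obtain S1 c1 where S1: "finite S1" "\<And>\<mu> m. (\<mu>, m) \<in> S1 \<Longrightarrow> Re \<mu> \<ge> 0 \<and> (\<mu>, m) \<noteq> (0, 0)"
    "\<And>\<epsilon>. \<epsilon> > 0 \<Longrightarrow> D1 \<epsilon> = (\<Sum>(\<mu>, m)\<in>S1. c1 (\<mu>, m) * of_real \<epsilon> powr (- \<mu>) * of_real (ln \<epsilon>) ^ m)"
    by (rule diverging_partE[OF D1]) (rule that)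
  obtain S2 c2 where S2: "finite S2" "\<And>\<mu> m. (\<mu>, m) \<in> S2 \<Longrightarrow> Re \<mu> \<ge> 0 \<and> (\<mu>, m) \<noteq> (0, 0)"
    "\<And>\<epsilon>. \<epsilon> > 0 \<Longrightarrow> D2 \<epsilon> = (\<Sum>(\<mu>, m)\<in>S2. c2 (\<mu>, m) * of_real \<epsilon> powr (- \<mu>) * of_real (ln \<epsilon>) ^ m)"
    by (rule diverging_partE[OF D2]) (rule that)
  define M where "M = insert 0 (fst ` S1 \<union> fst ` S2)"
  have M: "finite M" "\<And>\<mu>. \<mu> \<in> M \<Longrightarrow> Re \<mu> \<ge> 0"
    using S1 S2 by (auto simp: M_def)
  define P where "P = (\<lambda>(S :: (complex \<times> nat) set) (c :: complex \<times> nat \<Rightarrow> complex) \<mu>.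
    \<Sum>s\<in>{s\<in>S. fst s = \<mu>}. monom (c s) (snd s))"
  define p where "p = (\<lambda>\<mu>. P S1 c1 \<mu> - P S2 c2 \<mu> - (if \<mu> = 0 then [:L:] else 0))"
  have P: "(\<Sum>\<mu>\<in>M. poly (P S c \<mu>) (of_real y) * exp (- \<mu> * of_real y)) =
      (\<Sum>(\<mu>, m)\<in>S. c (\<mu>, m) * of_real (exp y) powr (- \<mu>) * of_real (ln (exp y)) ^ m)"
    if "finite S" "fst ` S \<subseteq> M" for S c and y :: real
  proof -
    have "(\<Sum>\<mu>\<in>M. poly (P S c \<mu>) (of_real y) * exp (- \<mu> * of_real y)) =
      (\<Sum>\<mu>\<in>M. \<Sum>s\<in>{s\<in>S. fst s = \<mu>}. c s * of_real y ^ snd s * exp (- fst s * of_real y))"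
      unfolding P_def
      by (intro sum.cong refl) (auto simp: poly_sum poly_monom sum_distrib_right intro!: sum.cong)
    also have "\<dots> = (\<Sum>s\<in>S. c s * of_real y ^ snd s * exp (- fst s * of_real y))"
      using that M by (intro sum.group) auto
    also have "\<dots> = (\<Sum>(\<mu>, m)\<in>S. c (\<mu>, m) * of_real (exp y) powr (- \<mu>) * of_real (ln (exp y)) ^ m)"
      by (intro sum.cong refl) (auto simp: powr_def Ln_of_real simp flip: exp_of_real)
    finally show ?thesis .
  qed
  have "filterlim (exp :: real \<Rightarrow> real) (at_right 0) at_bot"
    using exp_at_bot by (auto simp: filterlim_at)
  with lim have "((\<lambda>y. D1 (exp y) - D2 (exp y)) \<longlongrightarrow> L) at_bot"
    by (rule filterlim_compose)
  then have "((\<lambda>y. D1 (exp y) - D2 (exp y) - L) \<longlongrightarrow> 0) at_bot"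
    by (simp add: LIM_zero_iff)
  moreover have "D1 (exp y) - D2 (exp y) - L =
      (\<Sum>\<mu>\<in>M. poly (p \<mu>) (of_real y) * exp (- \<mu> * of_real y))" for y
  proof -
    have "L = (\<Sum>\<mu>\<in>M. if \<mu> = 0 then L else 0)"
      using M by (simp add: M_def)
    also have "\<dots> = (\<Sum>\<mu>\<in>M. poly (if \<mu> = 0 then [:L:] else 0) (of_real y) * exp (- \<mu> * of_real y))"
      by (intro sum.cong) auto
    finally have "L = \<dots>" .
    moreover have "D1 (exp y) = (\<Sum>\<mu>\<in>M. poly (P S1 c1 \<mu>) (of_real y) * exp (- \<mu> * of_real y))"
      using P[of S1 c1 y] S1 by (simp add: M_def le_supI1 subset_insertI2)
    moreover have "D2 (exp y) = (\<Sum>\<mu>\<in>M. poly (P S2 c2 \<mu>) (of_real y) * exp (- \<mu> * of_real y))"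
      using P[of S2 c2 y] S2 by (simp add: M_def le_supI2 subset_insertI2)
    ultimately show ?thesis
      unfolding p_def poly_diff left_diff_distrib sum_subtractf by metis
  qed
  ultimately have "\<forall>\<mu>\<in>M. p \<mu> = 0"
    by (intro exp_poly_tendsto_0 M) simp_all
  then have "coeff (p 0) 0 = 0" by (simp add: M_def)
  moreover have "coeff (P S c 0) 0 = 0" if "(0, 0) \<notin> S"
    for S :: "(complex \<times> nat) set" and c
    unfolding P_def coeff_sum using that by (intro sum.neutral) auto
  moreover have "(0, 0) \<notin> S1" "(0, 0) \<notin> S2"
    using S1(2)[of 0 0] S2(2)[of 0 0] by blast+
  ultimately show "L = 0"
    by (simp add: p_def)
qed

lemma has_finite_part_integral_unique:
  assumes "0 < a" "has_finite_part_integral f I a" "has_finite_part_integral f J a"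
  shows "I = J"
proof -
  obtain C D where 1: "\<And>\<epsilon>. 0 < \<epsilon> \<Longrightarrow> \<epsilon> < a \<Longrightarrow> (f has_integral (C \<epsilon> + D \<epsilon>)) {\<epsilon>..a}"
    "diverging_part D" "(C \<longlongrightarrow> I) (at_right 0)"
    using assms(2) unfolding has_finite_part_integral_def by blast
  obtain C' D' where 2: "\<And>\<epsilon>. 0 < \<epsilon> \<Longrightarrow> \<epsilon> < a \<Longrightarrow> (f has_integral (C' \<epsilon> + D' \<epsilon>)) {\<epsilon>..a}"
    "diverging_part D'" "(C' \<longlongrightarrow> J) (at_right 0)"
    using assms(3) unfolding has_finite_part_integral_def by blast
  have "((\<lambda>\<epsilon>. C \<epsilon> - C' \<epsilon>) \<longlongrightarrow> I - J) (at_right 0)"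
    by (intro tendsto_intros 1 2)
  moreover have "\<forall>\<^sub>F \<epsilon> in at_right 0. C \<epsilon> - C' \<epsilon> = D' \<epsilon> - D \<epsilon>"
    using eventually_at_right_less[of "0::real"] eventually_at_right_real[OF assms(1)]
  proof eventually_elim
    case (elim \<epsilon>)
    then have "C \<epsilon> + D \<epsilon> = C' \<epsilon> + D' \<epsilon>"
      using has_integral_unique[OF 1(1) 2(1)] by auto
    then show ?case by (simp add: algebra_simps)
  qed
  ultimately have "((\<lambda>\<epsilon>. D' \<epsilon> - D \<epsilon>) \<longlongrightarrow> I - J) (at_right 0)"
    by (rule Lim_transform_eventually)
  then have "I - J = 0" by (rule diverging_part_tendsto[OF 2(2) 1(2)])
  then show ?thesis by simp
qed

end

theory Submission
  imports Defs
begin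

text \<open>
  Put $q = e^{-2\pi i\lambda} \neq 1$. The polynomial
  $P(x) = \sum_j \binom{n}{j} (2\pi i)^{n-j} \beta_j x^j$ satisfies
  $q P(x + 2\pi i) - P(x) = x^n$, so $k(z) z^{-\lambda} P(\ln z)$ jumps by exactly
  $k(t) t^{-\lambda} \ln^n t$ across the cut. In the coordinate $w = \ln z$ the contour lifts to
  a path $g$ in the strip $0 \le \mathrm{Im}\, w \le 2\pi$ from $\ln a$ to $\ln a + 2\pi i$, and the
  integrand becomes $\Phi(w) = k(e^w) e^{(1-\lambda)w} P(w)$, which has no cut. By Cauchy's theorem $g$ may be
  replaced by the three other sides of the rectangle between $\mathrm{Re}\, w = \ln\epsilon$ and
  $\mathrm{Re}\, w = \ln a$. The horizontal sides give
  $\int_\epsilon^a k(t) t^{-\lambda} \ln^n t\, dt$. On the vertical side $k$ is replaced by a Taylor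
  polynomial: since $\lambda$ is not an integer, each $e^{(m+1-\lambda)w} P(w)$ has a primitive of the
  same form, so the Taylor terms contribute only diverging terms, and the remainder
  tends to $0$.
\<close>

subsection \<open>The jump polynomial\<close>

text \<open>Single out one element of an (m+1)-element set: choosing the j elements outside its
  block and splitting them into l blocks produces every partition into l+1 blocks once. The
  induction on m uses Pascal's rule to split the sum and the Stirling recurrence to reduce the
  second half to the hypothesis for l and l - 1.\<close>

lemma sum_binomial_Stirling:
  "(\<Sum>j\<le>m. (m choose j) * Stirling j l) = Stirling (Suc m) (Suc l)"
proof (induction m arbitrary: l)
  case 0
  then show ?case by (cases l) auto
next
  case (Suc m)
  have "(\<Sum>j\<le>Suc m. (Suc m choose j) * Stirling j l) =
      Stirling 0 l + (\<Sum>j\<le>m. (Suc m choose Suc j) * Stirling (Suc j) l)"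
    by (subst sum.atMost_Suc_shift) simp
  also have "\<dots> = (Stirling 0 l + (\<Sum>j\<le>m. (m choose Suc j) * Stirling (Suc j) l)) +
      (\<Sum>j\<le>m. (m choose j) * Stirling (Suc j) l)"
    by (simp add: algebra_simps sum.distrib)
  also have "Stirling 0 l + (\<Sum>j\<le>m. (m choose Suc j) * Stirling (Suc j) l) =
      (\<Sum>j\<le>Suc m. (m choose j) * Stirling j l)"
    by (subst sum.atMost_Suc_shift) simp
  also have "\<dots> = Stirling (Suc m) (Suc l)"
    using Suc.IH by simp
  also have "(\<Sum>j\<le>m. (m choose j) * Stirling (Suc j) l) =
      l * Stirling (Suc m) (Suc l) + (if l = 0 then 0 else Stirling (Suc m) l)"
  proof (cases l)
    case (Suc l')
    have "(\<Sum>j\<le>m. (m choose j) * Stirling (Suc j) l) =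
        l * (\<Sum>j\<le>m. (m choose j) * Stirling j l) + (\<Sum>j\<le>m. (m choose j) * Stirling j l')"
      by (simp add: Suc sum_distrib_left sum.distrib[symmetric] algebra_simps)
    then show ?thesis using Suc.IH by (simp add: Suc)
  qed simp
  finally show ?case by (cases l) auto
qed

text \<open>
  The numbers \<open>beta_coeff m 0 lam\<close> have exponential generating function
  $1 / (q e^x - 1)$ with $q = e^{-2\pi i\lambda}$; the lemma compares coefficients in
  $q e^x \cdot \frac{1}{q e^x - 1} = \frac{1}{q e^x - 1} + 1$.
\<close>

lemma beta_coeff_recurrence:
  fixes lam :: complex
  defines "q \<equiv> exp (- 2 * pi * \<i> * lam)"
  assumes "q \<noteq> 1"
  shows "q * (\<Sum>j\<le>m. of_nat (m choose j) * beta_coeff j 0 lam) =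
    beta_coeff m 0 lam + (if m = 0 then 1 else 0)"
proof -
  define r where "r = (\<lambda>l. q ^ l / (q - 1) ^ Suc l)"
  have q1: "q - 1 \<noteq> 0" using assms by simp
  \<comment> \<open>All inner sums get the common upper limit m, because \<open>Stirling j l\<close>
    vanishes for l > j; this permits exchanging the two summations.\<close>
  have b: "beta_coeff j 0 lam = (\<Sum>l\<le>m. (- 1) ^ l * fact l * of_nat (Stirling j l) * r l)"
    if "j \<le> m" for j
  proof -
    have "beta_coeff j 0 lam = (\<Sum>l\<le>j. (- 1) ^ l * fact l * of_nat (Stirling j l) * r l)"
      unfolding beta_coeff_def r_def q_def exp_of_nat2_mult[symmetric]
      by (simp add: atMost_atLeast0 mult.commute)
    also have "\<dots> = (\<Sum>l\<le>m. (- 1) ^ l * fact l * of_nat (Stirling j l) * r l)"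
      using that by (intro sum.mono_neutral_left) auto
    finally show ?thesis .
  qed
  define s where "s = (\<lambda>l. (- 1) ^ l * fact l * (of_nat (Stirling m l) :: complex))"
  \<comment> \<open>This is (q - 1) r_{l+1} = q r_l, rearranged so that a factor q can be traded for
    an index shift.\<close>
  have r: "q * r (Suc l) = q * r l + r (Suc l)" for l
  proof -
    have "r (Suc l) = q / (q - 1) * r l" by (simp add: r_def)
    moreover have "q * (q / (q - 1)) = q + q / (q - 1)" using q1 by (simp add: field_simps)
    ultimately show ?thesis by (metis distrib_right mult.assoc)
  qed
  have "(\<Sum>j\<le>m. of_nat (m choose j) * beta_coeff j 0 lam) =
      (\<Sum>j\<le>m. \<Sum>l\<le>m. (- 1) ^ l * fact l * r l * of_nat ((m choose j) * Stirling j l))"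
    using b by (intro sum.cong refl) (simp add: sum_distrib_left mult_ac)
  also have "\<dots> = (\<Sum>l\<le>m. (- 1) ^ l * fact l * r l *
      of_nat (\<Sum>j\<le>m. (m choose j) * Stirling j l))"
    unfolding of_nat_sum sum_distrib_left by (rule sum.swap)
  \<comment> \<open>The Stirling recurrence is applied to \<open>Stirling (Suc m) (Suc l)\<close>;
    its factor l + 1 completes the factorial of \<open>s (Suc l)\<close>, and the sign change gives
    the minus.\<close>
  also have "\<dots> = (\<Sum>l\<le>m. s l * r l) - (\<Sum>l\<le>m. s (Suc l) * r l)"
    unfolding sum_binomial_Stirling sum_subtractf[symmetric] s_def
    by (intro sum.cong refl) (simp add: algebra_simps)
  finally have eq: "(\<Sum>j\<le>m. of_nat (m choose j) * beta_coeff j 0 lam) =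
      (\<Sum>l\<le>m. s l * r l) - (\<Sum>l\<le>m. s (Suc l) * r l)" .
  have "q * (\<Sum>j\<le>m. of_nat (m choose j) * beta_coeff j 0 lam) =
      (\<Sum>l\<le>m. s l * (q * r l)) - (\<Sum>l\<le>m. s (Suc l) * (q * r l))"
    unfolding eq right_diff_distrib sum_distrib_left by (simp add: mult.left_commute)
  also have "(\<Sum>l\<le>m. s l * (q * r l)) = (\<Sum>l\<le>Suc m. s l * (q * r l))"
    by (simp add: s_def)
  also have "\<dots> = s 0 * q * r 0 + (\<Sum>l\<le>m. s (Suc l) * (q * r (Suc l)))"
    by (subst sum.atMost_Suc_shift) simp
  also have "\<dots> = s 0 * q * r 0 + (\<Sum>l\<le>m. s (Suc l) * (q * r l)) + (\<Sum>l\<le>m. s (Suc l) * r (Suc l))"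
    unfolding r by (simp add: algebra_simps sum.distrib)
  \<comment> \<open>Here q r_0 = r_0 + 1, while \<open>s 0\<close> is 1 for m = 0 and 0 otherwise:
    this is the source of the inhomogeneous term.\<close>
  also have "s 0 * q * r 0 = s 0 * r 0 + (if m = 0 then 1 else 0)"
    using q1 by (cases m) (simp_all add: s_def r_def field_simps)
  also have "s 0 * r 0 + (if m = 0 then 1 else 0) + (\<Sum>l\<le>m. s (Suc l) * (q * r l)) +
        (\<Sum>l\<le>m. s (Suc l) * r (Suc l)) - (\<Sum>l\<le>m. s (Suc l) * (q * r l)) =
      (s 0 * r 0 + (\<Sum>l\<le>m. s (Suc l) * r (Suc l))) + (if m = 0 then 1 else 0)"
    by simp
  also have "s 0 * r 0 + (\<Sum>l\<le>m. s (Suc l) * r (Suc l)) = (\<Sum>l\<le>Suc m. s l * r l)"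
    by (subst sum.atMost_Suc_shift) simp
  also have "\<dots> = (\<Sum>l\<le>m. s l * r l)"
    by (simp add: s_def)
  also have "\<dots> = beta_coeff m 0 lam"
    using b[of m] by (simp add: s_def)
  finally show ?thesis .
qed

text \<open>Since \<open>beta_coeff n j lam\<close> depends only on n - j, these form an Appell
  sequence, with exponential generating function e^{xt} / (q e^{2 pi i t} - 1) in t; up to scaling
  they are Apostol-Euler polynomials.\<close>

definition beta_poly :: "nat \<Rightarrow> complex \<Rightarrow> complex poly" where
  "beta_poly n lam =
     (\<Sum>j\<le>n. monom (of_nat (n choose j) * (2 * pi * \<i>) ^ (n - j) * beta_coeff n j lam) j)"

text \<open>After expanding (x + 2 pi i)^j and collecting powers of x, the coefficient of x^i
  contains exactly the sum evaluated by \<open>beta_coeff_recurrence\<close> at n - i. The extra 1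
  there occurs only for i = n and produces x^n.\<close>

lemma beta_poly_monodromy:
  fixes lam x :: complex
  assumes q: "exp (- 2 * pi * \<i> * lam) \<noteq> 1"
  shows "exp (- 2 * pi * \<i> * lam) * poly (beta_poly n lam) (x + 2 * pi * \<i>) -
    poly (beta_poly n lam) x = x ^ n"
proof -
  define T where "T = 2 * complex_of_real pi * \<i>"
  define b where "b = (\<lambda>m. beta_coeff m 0 lam)"
  have P: "poly (beta_poly n lam) y = (\<Sum>j\<le>n. of_nat (n choose j) * T ^ (n - j) * b (n - j) * y ^ j)" for y
    by (simp add: beta_poly_def poly_sum poly_monom b_def T_def beta_coeff_def)
  have "poly (beta_poly n lam) (x + T) =
      (\<Sum>j\<le>n. \<Sum>i\<le>j. of_nat (n choose j) * T ^ (n - j) * b (n - j) *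
        (of_nat (j choose i) * x ^ i * T ^ (j - i)))"
    by (simp add: P binomial_ring sum_distrib_left)
  also have "\<dots> = (\<Sum>j\<le>n. \<Sum>i\<le>j. of_nat (n choose i) * x ^ i * T ^ (n - i) *
        (of_nat ((n - i) choose (n - j)) * b (n - j)))"
  proof (intro sum.cong refl, goal_cases)
    case (1 j i)
    then have ij: "i \<le> j" "j \<le> n" by auto
    have "(n choose j) * (j choose i) = (n choose i) * ((n - i) choose (j - i))"
      using ij by (rule choose_mult)
    also have "(n - i) choose (j - i) = (n - i) choose (n - j)"
      using ij binomial_symmetric[of "j - i" "n - i"] by simp
    finally have c: "of_nat (n choose j) * of_nat (j choose i) =
        (of_nat (n choose i) * of_nat ((n - i) choose (n - j)) :: complex)"
      by (metis of_nat_mult)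
    have T: "T ^ (n - j) * T ^ (j - i) = T ^ (n - i)"
      using ij by (simp flip: power_add)
    have "of_nat (n choose j) * T ^ (n - j) * b (n - j) * (of_nat (j choose i) * x ^ i * T ^ (j - i)) =
        (of_nat (n choose j) * of_nat (j choose i)) * (T ^ (n - j) * T ^ (j - i)) * b (n - j) * x ^ i"
      by simp
    also have "\<dots> = of_nat (n choose i) * x ^ i * T ^ (n - i) * (of_nat ((n - i) choose (n - j)) * b (n - j))"
      unfolding c T by simp
    finally show ?case .
  qed
  also have "\<dots> = (\<Sum>i\<le>n. \<Sum>j=i..n. of_nat (n choose i) * x ^ i * T ^ (n - i) *
        (of_nat ((n - i) choose (n - j)) * b (n - j)))"
    unfolding sum.Sigma[OF finite_atMost ballI[OF finite_atMost]] sum.Sigma[OF finite_atMost ballI[OF finite_atLeastAtMost]]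
    by (intro sum.reindex_bij_witness[of _ prod.swap prod.swap]) auto
  also have "\<dots> = (\<Sum>i\<le>n. of_nat (n choose i) * x ^ i * T ^ (n - i) *
      (\<Sum>r\<le>n - i. of_nat ((n - i) choose r) * b r))"
    unfolding sum_distrib_left
    by (intro sum.cong refl sum.reindex_bij_witness[of _ "\<lambda>r. n - r" "\<lambda>j. n - j"]) auto
  finally have "exp (- 2 * pi * \<i> * lam) * poly (beta_poly n lam) (x + T) =
      (\<Sum>i\<le>n. of_nat (n choose i) * x ^ i * T ^ (n - i) *
      (exp (- 2 * pi * \<i> * lam) * (\<Sum>r\<le>n - i. of_nat ((n - i) choose r) * b r)))"
    by (simp add: sum_distrib_left mult_ac)
  also have "\<dots> = (\<Sum>i\<le>n. of_nat (n choose i) * x ^ i * T ^ (n - i) *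
      (b (n - i) + (if n - i = 0 then 1 else 0)))"
    unfolding b_def beta_coeff_recurrence[OF q] ..
  also have "\<dots> = poly (beta_poly n lam) x +
      (\<Sum>i\<le>n. if i = n then x ^ n else 0)"
    unfolding P sum.distrib[symmetric]
    by (intro sum.cong refl) (auto simp: algebra_simps)
  finally show ?thesis by (simp add: T_def)
qed

subsection \<open>The contour in the logarithmic coordinate\<close>

text \<open>Near a parameter t the lift equals \<open>q t + Ln (p u / p t)\<close>, so it inherits
  the derivative D / p wherever p is differentiable.\<close>

lemma valid_path_logarithm:
  fixes p q :: "real \<Rightarrow> complex"
  assumes "valid_path p" "path q" and pq: "\<And>t. t \<in> {0..1} \<Longrightarrow> p t = exp (q t)"
  shows "valid_path q"
proof -
  from \<open>valid_path p\<close> obtain S where S: "finite S" "p C1_differentiable_on {0..1} - S"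
    and cp: "continuous_on {0..1} p"
    unfolding valid_path_def piecewise_C1_differentiable_on_def by blast
  obtain D where D: "\<And>t. t \<in> {0..1} - S \<Longrightarrow> (p has_vector_derivative D t) (at t)"
    "continuous_on ({0..1} - S) D"
    using S(2) unfolding C1_differentiable_on_def by blast
  have cq: "continuous_on {0..1} q" using \<open>path q\<close> by (simp add: path_def)
  \<comment> \<open>The endpoints join the exceptional set so that every remaining t has a two-sided
    neighbourhood inside [0, 1].\<close>
  define S' where "S' = insert 0 (insert 1 S)"
  have "(q has_vector_derivative D t / p t) (at t)" if t: "t \<in> {0..1} - S'" for t
  proof -
    have t01: "0 < t" "t < 1" "t \<in> {0..1} - S" using t by (auto simp: S'_def)
    \<comment> \<open>Staying within distance 1 < pi of \<open>q t\<close> keeps the imaginary part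
      of the difference in the range where \<open>Ln\<close> inverts \<open>exp\<close>.\<close>
    obtain d where d: "d > 0" "\<And>u. u \<in> {0..1} \<Longrightarrow> dist u t < d \<Longrightarrow> dist (q u) (q t) < 1"
      using cq t01 unfolding continuous_on_iff by (metis DiffD1 zero_less_one)
    have near: "q t + Ln (p u / p t) = q u" if u: "dist u t < min d (min t (1 - t))" for u
    proof -
      have u01: "u \<in> {0..1}" using u by (auto simp: dist_real_def)
      have "dist (q u) (q t) < 1" using d u u01 by auto
      then have "\<bar>Im (q u - q t)\<bar> < 1"
        using abs_Im_le_cmod[of "q u - q t"] by (simp add: dist_norm)
      then have "- pi < Im (q u - q t)" "Im (q u - q t) \<le> pi"
        using pi_gt3 by linarith+
      then have "Ln (exp (q u - q t)) = q u - q t" by (rule Ln_exp)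
      then show ?thesis using pq[OF u01] pq[of t] t01 by (simp add: exp_diff)
    qed
    have pt: "p t \<noteq> 0" using pq[of t] t01 by simp
    have "((\<lambda>z. q t + Ln (z / p t)) has_field_derivative 1 / p t) (at (p t))"
      using pt by (auto intro!: derivative_eq_intros)
    from field_vector_diff_chain_at[OF D(1)[OF t01(3)] this]
    have "((\<lambda>u. q t + Ln (p u / p t)) has_vector_derivative D t / p t) (at t)"
      by (simp add: o_def)
    then show ?thesis
      by (rule has_vector_derivative_transform_within[where d = "min d (min t (1 - t))"])
        (use near d t01 in auto)
  qed
  moreover have "continuous_on ({0..1} - S') (\<lambda>t. D t / p t)"
    using pq by (intro continuous_on_divide continuous_on_subset[OF D(2)] continuous_on_subset[OF cp])
      (auto simp: S'_def)
  ultimately have "q C1_differentiable_on {0..1} - S'"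
    unfolding C1_differentiable_on_def by (intro exI[of _ "\<lambda>t. D t / p t"]) blast
  moreover have "finite S'" using S by (simp add: S'_def)
  ultimately show ?thesis
    unfolding valid_path_def piecewise_C1_differentiable_on_def using cq by blast
qed

lemma ln_cut_exp:
  assumes "0 \<le> Im w" "Im w < 2 * pi"
  shows "ln_cut (exp w) = w"
  using assms by (simp add: ln_cut_def Arg2pi_exp complex_eq_iff)

text \<open>A continuous logarithm exists because the contour misses 0, and winding number 1 makes
  it gain 2 pi i. Avoiding the cut keeps the height off all multiples of 2 pi in the interior; since
  the path leaves upwards, connectedness confines it to the strip.\<close>

lemma cut_contour_logarithm:
  assumes "0 < a" "cut_contour k a C"
  obtains g where "valid_path g" "pathstart g = of_real (ln a)"
    "pathfinish g = of_real (ln a) + 2 * pi * \<i>"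
    "\<And>t. t \<in> {0..1} \<Longrightarrow> C t = exp (g t)"
    "\<And>t. t \<in> {0<..<1} \<Longrightarrow> 0 < Im (g t) \<and> Im (g t) < 2 * pi"
proof -
  have C: "valid_path C" "C 0 = of_real a" "C 1 = of_real a"
    "\<And>t. t \<in> {0<..<1} \<Longrightarrow> C t \<notin> complex_of_real ` {0..}"
    "\<forall>\<^sub>F t in at_right 0. Im (C t) > 0" "winding_number C 0 = 1"
    using assms by (auto simp: cut_contour_def pathstart_def pathfinish_def)
  have "C t \<noteq> 0" if "t \<in> {0..1}" for t
  proof (cases "t \<in> {0<..<1}")
    case True
    then show ?thesis using C(4)[OF True] by force
  next
    case False
    then have "t = 0 \<or> t = 1" using that by auto
    then show ?thesis using C assms by auto
  qed
  then have "0 \<notin> path_image C" by (auto simp: path_image_def)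
  then obtain q where q: "path q" "pathfinish q - pathstart q = 2 * of_real pi * \<i> * winding_number C 0"
    "\<And>t. t \<in> {0..1} \<Longrightarrow> C t = 0 + exp (q t)"
    using winding_number_as_continuous_log[OF valid_path_imp_path[OF C(1)]] by blast
  have "exp (q 0) = exp (of_real (ln a))"
    using q(3)[of 0] C(2) assms(1) by (simp add: exp_of_real)
  then obtain m :: int where m: "q 0 = of_real (ln a) + (of_int (2 * m) * pi) * \<i>"
    unfolding exp_eq by blast
  define g where "g = (\<lambda>t. q t - (of_int (2 * m) * pi) * \<i>)"
  have g: "path g" "g 0 = of_real (ln a)" "g 1 = of_real (ln a) + 2 * pi * \<i>"
    using q C m by (auto simp: g_def path_def pathstart_def pathfinish_def algebra_simps intro!: continuous_intros)
  have Cg: "C t = exp (g t)" if "t \<in> {0..1}" for t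
  proof -
    have "exp (q t) = exp (g t)"
      unfolding exp_eq g_def by (intro exI[of _ m]) simp
    then show ?thesis using q(3)[OF that] by simp
  qed
  have nz: "Im (g t) \<noteq> 2 * pi * of_int i" if "t \<in> {0<..<1}" for t i
  proof
    assume i: "Im (g t) = 2 * pi * of_int i"
    have "exp (g t) = of_real (exp (Re (g t)))"
      unfolding exp_eq_polar[of "g t"] i by (simp add: cis_multiple_2pi)
    then show False using C(4)[OF that] Cg[of t] that by auto
  qed
  have cg: "continuous_on {0..1} g" using g by (simp add: path_def)
  have "\<forall>\<^sub>F t in at_right 0. dist (g t) (g 0) < 1"
    using tendstoD[OF continuous_on_Icc_at_rightD[OF cg zero_less_one] zero_less_one] .
  moreover have "\<forall>\<^sub>F t::real in at_right 0. t \<in> {0<..<1}"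
    by (rule eventually_at_right_real) simp
  ultimately have "\<forall>\<^sub>F t in at_right 0. dist (g t) (g 0) < 1 \<and> t \<in> {0<..<1} \<and> Im (C t) > 0"
    using C(5) by eventually_elim auto
  \<comment> \<open>A sample point soon after the start: its height is below 1 in absolute value and
    has positive sine, hence lies in (0, 1).\<close>
  then obtain u where u: "dist (g u) (g 0) < 1" "u \<in> {0<..<1}" "Im (C u) > 0"
    using eventually_happens trivial_limit_at_right_real by blast
  have "\<bar>Im (g u)\<bar> < 1"
    using u(1) abs_Im_le_cmod[of "g u - g 0"] g(2) by (simp add: dist_norm)
  moreover have "sin (Im (g u)) > 0"
    using u Cg[of u] by (simp add: Im_exp zero_less_mult_iff)
  moreover have "sin (Im (g u)) \<le> 0" if "- 1 < Im (g u)" "Im (g u) \<le> 0"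
    using sin_ge_zero[of "- Im (g u)"] that pi_gt3 by simp
  ultimately have gu: "0 < Im (g u)" "Im (g u) < 1" by linarith+
  \<comment> \<open>The set of interior heights is an interval that contains \<open>Im (g u)\<close>
    but neither 0 nor 2 pi.\<close>
  define A where "A = (\<lambda>t. Im (g t)) ` {0<..<1}"
  have "connected A"
    unfolding A_def by (intro connected_continuous_image continuous_intros continuous_on_subset[OF cg]) auto
  then have icc: "{x..y} \<subseteq> A" if "x \<in> A" "y \<in> A" for x y
    using that connected_contains_Icc by blast
  have "Im (g t) \<noteq> 0" "Im (g t) \<noteq> 2 * pi" if "t \<in> {0<..<1}" for t
    using nz[OF that, of 0] nz[OF that, of 1] by simp_all
  then have notin: "0 \<notin> A" "2 * pi \<notin> A"
    unfolding A_def by fastforce+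
  have uA: "Im (g u) \<in> A" using u by (auto simp: A_def)
  have "0 < Im (g t) \<and> Im (g t) < 2 * pi" if "t \<in> {0<..<1}" for t
  proof -
    have tA: "Im (g t) \<in> A" using that by (auto simp: A_def)
    show ?thesis
    proof (intro conjI; rule ccontr)
      assume "\<not> 0 < Im (g t)"
      then have "0 \<in> {Im (g t)..Im (g u)}" using gu by auto
      then show False using icc[OF tA uA] notin by blast
    next
      assume "\<not> Im (g t) < 2 * pi"
      then have "2 * pi \<in> {Im (g u)..Im (g t)}" using gu pi_gt3 by auto
      then show False using icc[OF uA tA] notin by blast
    qed
  qed
  then show thesis
    using that[of g] valid_path_logarithm[OF C(1) g(1) Cg] g Cg by (simp add: pathstart_def pathfinish_def)
qed

text \<open>Substitution z = e^w: the derivative e^w combines with z^{-lam} into e^{(1 - lam)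
  w}.\<close>

lemma contour_integral_exp_cut:
  assumes "valid_path g" and C: "\<And>t. t \<in> {0..1} \<Longrightarrow> C t = exp (g t)"
    and strip: "\<And>t. t \<in> {0<..<1} \<Longrightarrow> 0 < Im (g t) \<and> Im (g t) < 2 * pi"
  shows "contour_integral C (\<lambda>z. k z / powr_cut z lam * ln_cut z ^ j) =
    contour_integral g (\<lambda>w. k (exp w) * exp ((1 - lam) * w) * w ^ j)"
    (is "contour_integral C ?f = contour_integral g ?F")
proof -
  have "contour_integral C ?f = contour_integral (exp \<circ> g) ?f"
    unfolding contour_integral_integral
  \<comment> \<open>The two paths are only known to agree on [0, 1], so their derivatives at the
    endpoints may differ.\<close>
  proof (rule integral_spike[of "{0, 1}"])
    fix t :: real assume "t \<in> {0..1} - {0, 1}"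
    then have t: "t \<in> {0<..<1}" by auto
    have "\<forall>\<^sub>F u in nhds t. u \<in> {0<..<1}"
      using t by (intro eventually_nhds_in_open) auto
    then have "\<forall>\<^sub>F u in nhds t. C u = (exp \<circ> g) u"
      by eventually_elim (use C in auto)
    then have "vector_derivative C (at t) = vector_derivative (exp \<circ> g) (at t)"
      by (intro vector_derivative_cong_eq) auto
    then show "?f ((exp \<circ> g) t) * vector_derivative (exp \<circ> g) (at t) = ?f (C t) * vector_derivative C (at t)"
      using C[of t] t by simp
  qed simp
  also have "\<dots> = contour_integral g (\<lambda>w. deriv exp w * ?f (exp w))"
    by (rule contour_integral_comp_analyticW[of _ UNIV]) (use assms in \<open>auto intro!: analytic_intros\<close>)
  also have "\<dots> = contour_integral g ?F"
    unfolding contour_integral_integral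
  \<comment> \<open>The strip condition covers only interior parameters; for the lifted contour,
    \<open>ln_cut\<close> gives ln a at t = 1 instead of ln a + 2 pi i.\<close>
  proof (rule integral_spike[of "{0, 1}"])
    fix t :: real assume "t \<in> {0..1} - {0, 1}"
    then have "ln_cut (exp (g t)) = g t" using strip[of t] by (intro ln_cut_exp) auto
    moreover have "deriv exp (g t) = exp (g t)" by (intro DERIV_imp_deriv DERIV_exp)
    ultimately show "?F (g t) * vector_derivative g (at t) =
        deriv exp (g t) * ?f (exp (g t)) * vector_derivative g (at t)"
      by (simp add: powr_cut_def left_diff_distrib exp_diff)
  qed simp
  finally show ?thesis .
qed

section \<open>Closing the lifted contour and applying Cauchy's theorem\<close>

text \<open>With L = ln a and l = ln eps this is the logarithmic image of a keyhole contour: after g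
  it runs inwards along the lower side of the cut, clockwise around the circle of radius eps, and
  outwards along the upper side.\<close>

definition log_loop :: "(real \<Rightarrow> complex) \<Rightarrow> real \<Rightarrow> real \<Rightarrow> real \<Rightarrow> complex" where
  "log_loop g L l = g +++ linepath (of_real L + 2 * pi * \<i>) (of_real l + 2 * pi * \<i>) +++
     linepath (of_real l + 2 * pi * \<i>) (of_real l) +++ linepath (of_real l) (of_real L)"

lemma contour_integral_linepath_shift:
  "contour_integral (linepath (a + c) (b + c)) f = contour_integral (linepath a b) (\<lambda>w. f (w + c))"
  unfolding contour_integral_integral
  by (simp add: linepath_def algebra_simps)

text \<open>The horizontal sides are translates of each other run in opposite directions, so
  together they integrate the jump of F.\<close>

lemma contour_integral_log_loop:
  assumes g: "valid_path g" "pathstart g = of_real L" "pathfinish g = of_real L + 2 * pi * \<i>"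
    and F: "open W" "F holomorphic_on W" "path_image (log_loop g L l) \<subseteq> W"
  shows "contour_integral (log_loop g L l) F = contour_integral g F -
    contour_integral (linepath (of_real l) (of_real L)) (\<lambda>w. F (w + 2 * pi * \<i>) - F w) -
    contour_integral (linepath (of_real l) (of_real l + 2 * pi * \<i>)) F"
proof -
  let ?T = "2 * complex_of_real pi * \<i>"
  have sub: "path_image g \<subseteq> W" "path_image (linepath (of_real L + ?T) (of_real l + ?T)) \<subseteq> W"
    "path_image (linepath (of_real l + ?T) (of_real l)) \<subseteq> W"
    "path_image (linepath (of_real l) (of_real L :: complex)) \<subseteq> W"
    using F(3) g by (simp_all add: log_loop_def path_image_join)
  have int: "F contour_integrable_on p" if "valid_path p" "path_image p \<subseteq> W" for p
    using contour_integrable_holomorphic_simple[OF F(2,1) that] .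
  have ints: "F contour_integrable_on g"
    "F contour_integrable_on linepath (of_real L + ?T) (of_real l + ?T)"
    "F contour_integrable_on linepath (of_real l + ?T) (of_real l)"
    "F contour_integrable_on linepath (of_real l) (of_real L)"
    using int g(1) sub by simp_all
  have rev: "contour_integral (linepath (of_real L + ?T) (of_real l + ?T)) F =
      - contour_integral (linepath (of_real l + ?T) (of_real L + ?T)) F"
    "contour_integral (linepath (of_real l + ?T) (of_real l)) F =
      - contour_integral (linepath (of_real l) (of_real l + ?T)) F"
    using contour_integral_reversepath[of "linepath (of_real L + ?T) (of_real l + ?T)" F]
      contour_integral_reversepath[of "linepath (of_real l + ?T) (of_real l)" F] by simp_all
  have cont: "continuous_on (closed_segment (of_real l) (of_real L)) F"
    "continuous_on ((\<lambda>w. w + ?T) ` closed_segment (of_real l) (of_real L)) F"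
  proof -
    show "continuous_on (closed_segment (of_real l) (of_real L)) F"
      using holomorphic_on_imp_continuous_on[OF F(2)] sub by (auto intro: continuous_on_subset)
    have "(\<lambda>w. w + ?T) ` closed_segment (of_real l) (of_real L) =
        path_image (linepath (of_real L + ?T) (of_real l + ?T))"
      unfolding path_image_linepath add.commute[of _ ?T] closed_segment_translation
      by (simp only: closed_segment_commute)
    then show "continuous_on ((\<lambda>w. w + ?T) ` closed_segment (of_real l) (of_real L)) F"
      using holomorphic_on_imp_continuous_on[OF F(2)] sub by (auto intro: continuous_on_subset)
  qed
  have "contour_integral (linepath (of_real l) (of_real L)) (\<lambda>w. F (w + ?T) - F w) =
      contour_integral (linepath (of_real l + ?T) (of_real L + ?T)) F -
      contour_integral (linepath (of_real l) (of_real L)) F"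
    unfolding contour_integral_linepath_shift
    by (intro contour_integral_diff contour_integrable_continuous_linepath cont
        continuous_on_compose2[OF cont(2)] continuous_intros) auto
  then show ?thesis
    using ints g unfolding log_loop_def
    by (simp add: rev contour_integral_join valid_path_join contour_integrable_joinI)
qed

text \<open>A proper convex combination lies strictly inside the strip unless both points are on the
  same edge. Cutting the edges off at L puts the edge points to the right of ln a outside a convex
  set containing the loop, which makes their winding number vanish.\<close>

lemma convex_half_open_strip:
  assumes "c > 0"
  shows "convex {w. 0 < Im w \<and> Im w < c \<or> (Im w = 0 \<or> Im w = c) \<and> Re w \<le> L}" (is "convex ?S")
proof (rule convexI)
  fix x y :: complex and u v :: real
  assume x: "x \<in> ?S" and y: "y \<in> ?S" and uv: "0 \<le> u" "0 \<le> v" "u + v = 1"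
  show "u *\<^sub>R x + v *\<^sub>R y \<in> ?S"
  proof (cases "u = 0 \<or> v = 0")
    case True
    then show ?thesis using x y uv by auto
  next
    case False
    then have uv0: "u > 0" "v > 0" using uv by auto
    have v: "v = 1 - u" using uv by simp
    have xy: "0 \<le> Im x" "Im x \<le> c" "0 \<le> Im y" "Im y \<le> c" using x y \<open>c > 0\<close> by auto
    show ?thesis
    proof (cases "(Im x = 0 \<and> Im y = 0) \<or> (Im x = c \<and> Im y = c)")
      case True
      then have "Re x \<le> L" "Re y \<le> L" using x y \<open>c > 0\<close> by auto
      then have "u * Re x + v * Re y \<le> u * L + v * L"
        using uv0 by (intro add_mono mult_left_mono) auto
      also have "\<dots> = L" by (simp add: v algebra_simps)
      finally show ?thesis using True by (auto simp: v algebra_simps)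
    next
      case ne: False
      have "0 < u * Im x + v * Im y"
      proof (cases "Im x = 0")
        case True
        then have "Im y > 0" using ne xy by linarith
        then show ?thesis using True uv0 by simp
      next
        case False
        then show ?thesis using xy uv0 by (intro add_pos_nonneg mult_pos_pos) auto
      qed
      moreover have "0 < u * (c - Im x) + v * (c - Im y)"
      proof (cases "Im x = c")
        case True
        then have "Im y < c" using ne xy by linarith
        then show ?thesis using True uv0 by simp
      next
        case False
        then show ?thesis using xy uv0 by (intro add_pos_nonneg mult_pos_pos) auto
      qed
      ultimately show ?thesis by (simp add: v algebra_simps)
    qed
  qed
qed

lemma path_image_log_loop:
  assumes "pathfinish g = of_real L + 2 * pi * \<i>"
  shows "path_image (log_loop g L l) = path_image g \<union>
    closed_segment (of_real L + 2 * pi * \<i>) (of_real l + 2 * pi * \<i>) \<union>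
    closed_segment (of_real l + 2 * pi * \<i>) (of_real l) \<union> closed_segment (of_real l) (of_real L)"
  using assms by (simp add: log_loop_def path_image_join Un_assoc)

lemma valid_path_log_loop:
  assumes "valid_path g" "pathfinish g = of_real L + 2 * pi * \<i>"
  shows "valid_path (log_loop g L l)"
  using assms by (simp add: log_loop_def valid_path_join)

lemma log_loop_closed:
  assumes "pathstart g = of_real L"
  shows "pathfinish (log_loop g L l) = pathstart (log_loop g L l)"
  using assms by (simp add: log_loop_def)

lemma path_image_log_loop_subset_convex:
  assumes "convex S" "path_image g \<subseteq> S" "pathfinish g = of_real L + 2 * pi * \<i>"
    and "of_real L \<in> S" "of_real L + 2 * pi * \<i> \<in> S"
    and "of_real l \<in> S" "of_real l + 2 * pi * \<i> \<in> S"
  shows "path_image (log_loop g L l) \<subseteq> S"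
  unfolding path_image_log_loop[OF assms(3)] using assms by (intro Un_least closed_segment_subset) auto

text \<open>To the left of w0 one has |e^{w - w0}| < 1, so Ln (1 - e^{w - w0}) is a primitive; it is
  2 pi i periodic and takes equal values at both ends of the side.\<close>

lemma contour_integral_vertical_dlog:
  assumes "l < Re w0"
  shows "contour_integral (linepath (of_real l) (of_real l + 2 * pi * \<i>)) (\<lambda>w. exp w / (exp w - exp w0)) = 0"
proof -
  let ?S = "{w. Re w < Re w0}"
  have "((\<lambda>w. Ln (1 - exp w / exp w0)) has_field_derivative exp w / (exp w - exp w0)) (at w within ?S)"
    if "w \<in> ?S" for w
  proof -
    have lt: "norm (exp w / exp w0) < 1"
      using that by (simp add: norm_divide)
    then have ne: "exp w / exp w0 \<noteq> 1" by auto
    have "\<bar>Re (exp w / exp w0)\<bar> < 1" using lt abs_Re_le_cmod order.strict_trans1 by blast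
    then have "Re (1 - exp w / exp w0) > 0" by simp
    then have "1 - exp w / exp w0 \<notin> \<real>\<^sub>\<le>\<^sub>0"
      using complex_nonpos_Reals_iff by (metis not_less)
    then have "((\<lambda>w. Ln (1 - exp w / exp w0)) has_field_derivative
        inverse (1 - exp w / exp w0) * (0 - exp w / exp w0)) (at w within ?S)"
      by (intro DERIV_chain2[of Ln _ "\<lambda>w. 1 - exp w / exp w0", OF has_field_derivative_Ln] derivative_eq_intros refl) auto
    also have "inverse (1 - exp w / exp w0) * (0 - exp w / exp w0) = exp w / (exp w - exp w0)"
      using ne by (simp add: field_simps)
    finally show ?thesis .
  qed
  moreover have "path_image (linepath (of_real l) (of_real l + 2 * pi * \<i>)) \<subseteq> ?S"
  proof -
    have "convex ?S" by (rule convex_halfspace_Re_lt)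
    then show ?thesis using assms by (simp add: closed_segment_subset)
  qed
  ultimately have "((\<lambda>w. exp w / (exp w - exp w0)) has_contour_integral
      (Ln (1 - exp (of_real l + 2 * pi * \<i>) / exp w0) - Ln (1 - exp (of_real l) / exp w0)))
      (linepath (of_real l) (of_real l + 2 * pi * \<i>))"
    using contour_integral_primitive[of ?S "\<lambda>w. Ln (1 - exp w / exp w0)" "\<lambda>w. exp w / (exp w - exp w0)"
        "linepath (of_real l) (of_real l + 2 * pi * \<i>)"] by simp
  then show ?thesis by (simp add: contour_integral_unique exp_add)
qed

text \<open>
  The only zero of \<open>exp w - exp w0\<close> in the strip of half-height $2\pi$ around \<open>w0\<close> is \<open>w0\<close>, so
  the winding number is the integral of the logarithmic derivative of \<open>exp w - exp w0\<close>. That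
  integral can be evaluated after applying \<open>exp\<close>, where the horizontal sides cancel.
\<close>

lemma winding_number_log_loop:
  assumes g: "valid_path g" "pathstart g = of_real L" "pathfinish g = of_real L + 2 * pi * \<i>"
    and strip: "\<And>w. w \<in> path_image g \<Longrightarrow> 0 \<le> Im w \<and> Im w \<le> 2 * pi"
    and w0: "0 < Im w0" "Im w0 < 2 * pi" "l < Re w0"
    and out: "exp w0 \<notin> path_image (exp \<circ> g)" "winding_number (exp \<circ> g) (exp w0) = 0"
  shows "winding_number (log_loop g L l) w0 = 0"
proof -
  define F where "F = (\<lambda>w. exp w / (exp w - exp w0))"
  define S where "S = {w. Im w0 - 2 * pi < Im w} \<inter> {w. Im w < Im w0 + 2 * pi}"
  have S: "open S" "convex S"
    unfolding S_def by (auto intro: open_halfspace_Im_gt open_halfspace_Im_lt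
        convex_Int convex_halfspace_Im_gt convex_halfspace_Im_lt)
  have unique: "w = w0" if "w \<in> S" "exp w = exp w0" for w
  proof -
    obtain n :: int where n: "w = w0 + (of_int (2 * n) * pi) * \<i>"
      using \<open>exp w = exp w0\<close> unfolding exp_eq by blast
    have "Im w = Im w0 + 2 * pi * of_int n" by (simp add: n)
    then have "2 * pi * \<bar>of_int n\<bar> < 2 * pi * 1"
      using that(1) by (auto simp: S_def abs_mult abs_less_iff simp flip: abs_mult_pos')
    then have "n = 0" by simp
    then show ?thesis using n by simp
  qed
  have hol: "F holomorphic_on S - {w0}"
    unfolding F_def using unique by (intro holomorphic_intros) auto
  \<comment> \<open>The difference quotient of \<open>exp\<close> at w0 shows that the pole of F is
    simple with residue 1.\<close>
  have "((\<lambda>w. (exp w - exp w0) / (w - w0)) \<longlongrightarrow> exp w0) (at w0)"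
    using DERIV_exp[of w0] by (simp add: has_field_derivative_iff)
  then have "((\<lambda>w. exp w / ((exp w - exp w0) / (w - w0))) \<longlongrightarrow> exp w0 / exp w0) (at w0)"
    by (intro tendsto_intros) auto
  then have "((\<lambda>w. F w * (w - w0)) \<longlongrightarrow> 1) (at w0)"
    by (simp add: F_def)
  then have res: "residue F w0 = 1"
    by (intro residue_simple'[OF S(1) _ hol]) (use w0 in \<open>auto simp: S_def\<close>)
  have sub: "path_image (log_loop g L l) \<subseteq> S"
    using strip w0 by (intro path_image_log_loop_subset_convex S g) (force simp: S_def)+
  have "w0 \<notin> closed_segment (of_real L + 2 * pi * \<i>) (of_real l + 2 * pi * \<i>)"
    "w0 \<notin> closed_segment (of_real l) (of_real L)"
    "w0 \<notin> closed_segment (of_real l + 2 * pi * \<i>) (of_real l)"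
    using w0 by (auto simp: closed_segment_same_Im closed_segment_same_Re)
  moreover have "w0 \<notin> path_image g" using out by (auto simp: path_image_compose)
  ultimately have "w0 \<notin> path_image (log_loop g L l)"
    by (simp add: path_image_log_loop[OF g(3)])
  with sub have sub': "path_image (log_loop g L l) \<subseteq> S - {w0}" by auto
  have "contour_integral (log_loop g L l) F =
      2 * pi * \<i> * (\<Sum>p\<in>{w0}. winding_number (log_loop g L l) p * residue F p)"
  proof (rule Residue_theorem[OF S(1) convex_connected[OF S(2)] _ hol valid_path_log_loop[OF g(1,3)]
        log_loop_closed[OF g(2)] sub'])
    show "\<forall>z. z \<notin> S \<longrightarrow> winding_number (log_loop g L l) z = 0"
      using winding_number_zero_outside[OF valid_path_imp_path[OF valid_path_log_loop[OF g(1,3)]]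
          S(2) log_loop_closed[OF g(2)] _ sub] by blast
  qed simp
  \<comment> \<open>All three contributions vanish: the integral along g is 2 pi i times the winding
    number of \<open>exp \<circ> g\<close> about \<open>exp w0\<close>, the jump is 0 by
    periodicity, and the vertical side is covered by
    \<open>contour_integral_vertical_dlog\<close>.\<close>
  moreover have "contour_integral (log_loop g L l) F = 0"
  proof -
    have "contour_integral g F = contour_integral g (\<lambda>w. deriv exp w * (1 / (exp w - exp w0)))"
    proof (rule contour_integral_cong)
      fix w show "F w = deriv exp w * (1 / (exp w - exp w0))"
        using DERIV_imp_deriv[OF DERIV_exp[of w]] by (simp add: F_def)
    qed simp
    also have "\<dots> = contour_integral (exp \<circ> g) (\<lambda>z. 1 / (z - exp w0))"
      by (rule contour_integral_comp_analyticW[symmetric, of _ UNIV])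
        (use g in \<open>auto intro!: analytic_intros\<close>)
    also have "\<dots> = 2 * pi * \<i> * winding_number (exp \<circ> g) (exp w0)"
    proof -
      have "valid_path (exp \<circ> g)"
        by (rule valid_path_compose_holomorphic[OF g(1), of _ UNIV]) (auto intro: holomorphic_intros)
      then show ?thesis using winding_number_valid_path[of "exp \<circ> g" "exp w0"] out(1) by simp
    qed
    finally have "contour_integral g F = 0" using out by simp
    moreover have "F (w + 2 * pi * \<i>) - F w = 0" for w by (simp add: F_def exp_add)
    moreover have "contour_integral (linepath (of_real l) (of_real l + 2 * pi * \<i>)) F = 0"
      unfolding F_def by (rule contour_integral_vertical_dlog[OF w0(3)])
    ultimately show ?thesis
      using contour_integral_log_loop[OF g _ hol sub'] S(1) by (simp add: open_delete)
  qed
  ultimately show ?thesis using res by simp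
qed

text \<open>Cauchy's theorem for the closed loop in the preimage of U under \<open>exp\<close>. The
  work is to show winding number 0 around every point outside this preimage, using the corresponding
  hypothesis on \<open>exp \<circ> g\<close>.\<close>

lemma contour_integral_logarithm:
  assumes g: "valid_path g" "pathstart g = of_real (ln a)" "pathfinish g = of_real (ln a) + 2 * pi * \<i>"
    and strip: "\<And>t. t \<in> {0<..<1} \<Longrightarrow> 0 < Im (g t) \<and> Im (g t) < 2 * pi"
    and U: "open U" "path_image (exp \<circ> g) \<subseteq> U"
      "\<And>z. z \<notin> U \<Longrightarrow> winding_number (exp \<circ> g) z = 0"
      "complex_of_real ` {0..a} \<subseteq> U" "ball 0 r \<subseteq> U"
    and \<epsilon>: "0 < \<epsilon>" "\<epsilon> < a" "\<epsilon> < r"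
    and F: "F holomorphic_on {w. exp w \<in> U}"
  shows "contour_integral g F =
    contour_integral (linepath (of_real (ln \<epsilon>)) (of_real (ln a))) (\<lambda>w. F (w + 2 * pi * \<i>) - F w) +
    contour_integral (linepath (of_real (ln \<epsilon>)) (of_real (ln \<epsilon>) + 2 * pi * \<i>)) F"
proof -
  define l L where "l = ln \<epsilon>" and "L = ln a"
  have lL: "l < L" using \<epsilon> by (simp add: l_def L_def)
  note g = g[folded L_def]
  let ?\<Omega> = "{w. exp w \<in> U}"
  let ?\<Gamma> = "log_loop g L l"
  have \<Omega>: "open ?\<Omega>"
    using open_vimage[OF U(1), of exp] by (simp add: vimage_def continuous_on_exp)
  define S where "S = {w. 0 < Im w \<and> Im w < 2 * pi \<or> (Im w = 0 \<or> Im w = 2 * pi) \<and> Re w \<le> L}"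
  have S: "convex S"
    unfolding S_def by (rule convex_half_open_strip) simp
  have gS: "path_image g \<subseteq> S"
  proof
    fix w assume "w \<in> path_image g"
    then obtain t where t: "t \<in> {0..1}" "w = g t" by (auto simp: path_image_def)
    then have "t = 0 \<or> t = 1 \<or> t \<in> {0<..<1}" by auto
    then show "w \<in> S"
      using strip[of t] g(2,3) t(2) by (auto simp: S_def pathstart_def pathfinish_def)
  qed
  have sub: "path_image ?\<Gamma> \<subseteq> S"
    using lL by (intro path_image_log_loop_subset_convex S g gS) (auto simp: S_def)
  have real: "exp (of_real x) \<in> U" if "x \<le> L" for x
  proof -
    have "exp x \<le> a" using that \<epsilon> unfolding L_def by (simp add: ln_ge_iff)
    then show ?thesis using U(4) by (force simp: exp_of_real)
  qed
  have sub\<Omega>: "path_image ?\<Gamma> \<subseteq> ?\<Omega>"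
  proof -
    have "path_image g \<subseteq> ?\<Omega>" using U(2) by (auto simp: path_image_compose)
    moreover have h: "w \<in> ?\<Omega>" if "w \<in> closed_segment (of_real l) (of_real L)" for w
    proof -
      have "w \<in> \<real>" "Re w \<le> L"
        using that lL by (auto simp: closed_segment_same_Im closed_segment_eq_real_ivl complex_is_Real_iff)
      then show ?thesis using real[of "Re w"] by simp
    qed
    moreover have "w \<in> ?\<Omega>"
      if "w \<in> closed_segment (of_real L + 2 * pi * \<i>) (of_real l + 2 * pi * \<i>)" for w
    proof -
      have "w - 2 * pi * \<i> \<in> closed_segment (of_real l) (of_real L)"
        using that closed_segment_translation_eq[of "2 * pi * \<i>" "w - 2 * pi * \<i>" "of_real l" "of_real L"]
        by (simp add: closed_segment_commute add.commute)
      from h[OF this] show ?thesis by (simp add: exp_diff)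
    qed
    moreover have "w \<in> ?\<Omega>" if "w \<in> closed_segment (of_real l + 2 * pi * \<i>) (of_real l)" for w
    proof -
      have "Re w = l" using that by (auto simp: closed_segment_same_Re)
      then have "norm (exp w) = \<epsilon>" using \<epsilon> by (simp add: l_def)
      then have "exp w \<in> ball 0 r" using \<epsilon> by simp
      then show ?thesis using U(5) by auto
    qed
    ultimately show ?thesis unfolding path_image_log_loop[OF g(3)] by blast
  qed
  have "(F has_contour_integral 0) ?\<Gamma>"
  proof (rule Cauchy_theorem_global[OF \<Omega> F valid_path_log_loop[OF g(1,3)] log_loop_closed[OF g(2)] sub\<Omega>])
    \<comment> \<open>Points outside the convex set S are immediate. Edge points of S map into (0,
      a], which lies in U, so only interior points of the strip remain.\<close>
    fix w assume w: "w \<notin> ?\<Omega>"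
    show "winding_number ?\<Gamma> w = 0"
    proof (cases "w \<in> S")
      case False
      then show ?thesis
        using winding_number_zero_outside[OF valid_path_imp_path[OF valid_path_log_loop[OF g(1,3)]]
          S log_loop_closed[OF g(2)] _ sub] by blast
    next
      case True
      have "\<not> ((Im w = 0 \<or> Im w = 2 * pi) \<and> Re w \<le> L)"
      proof
        assume *: "(Im w = 0 \<or> Im w = 2 * pi) \<and> Re w \<le> L"
        then have "exp w = exp (of_real (Re w))" by (auto simp: exp_eq_polar[of w] exp_of_real)
        then show False using w real * by auto
      qed
      then have im: "0 < Im w" "Im w < 2 * pi" using True by (auto simp: S_def)
      \<comment> \<open>The disc of radius r > eps lies in U, so w is to the right of the vertical
        side, as \<open>winding_number_log_loop\<close> requires.\<close>
      have "exp w \<notin> ball 0 r" using w U(5) by blast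
      then have "\<epsilon> < exp (Re w)" using \<epsilon> by simp
      then have re: "l < Re w" using \<epsilon> unfolding l_def by (metis exp_gt_zero ln_exp ln_less_cancel_iff)
      show ?thesis
        by (rule winding_number_log_loop[OF g _ im re])
          (use w U(2,3) gS in \<open>auto simp: S_def\<close>)
    qed
  qed
  then have "contour_integral ?\<Gamma> F = 0" by (rule contour_integral_unique)
  then show ?thesis
    using contour_integral_log_loop[OF g \<Omega> F sub\<Omega>] by (simp add: l_def L_def algebra_simps)
qed

subsection \<open>The small circle\<close>

lemma diverging_part_0: "diverging_part (\<lambda>_. 0)"
  unfolding diverging_part_def by (intro exI[of _ "{}"]) auto

lemma diverging_part_add:
  assumes "diverging_part D1" "diverging_part D2"
  shows "diverging_part (\<lambda>\<epsilon>. D1 \<epsilon> + D2 \<epsilon>)"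
proof -
  let ?e = "\<lambda>(\<epsilon>::real) (s :: complex \<times> nat). of_real \<epsilon> powr (- fst s) * of_real (ln \<epsilon>) ^ snd s"
  obtain S1 c1 where S1: "finite S1" "\<And>\<mu> m. (\<mu>, m) \<in> S1 \<Longrightarrow> Re \<mu> \<ge> 0 \<and> (\<mu>, m) \<noteq> (0, 0)"
    "\<And>\<epsilon>. \<epsilon> > 0 \<Longrightarrow> D1 \<epsilon> = (\<Sum>(\<mu>, m)\<in>S1. c1 (\<mu>, m) * of_real \<epsilon> powr (- \<mu>) * of_real (ln \<epsilon>) ^ m)"
    by (rule diverging_partE[OF assms(1)]) (rule that)
  obtain S2 c2 where S2: "finite S2" "\<And>\<mu> m. (\<mu>, m) \<in> S2 \<Longrightarrow> Re \<mu> \<ge> 0 \<and> (\<mu>, m) \<noteq> (0, 0)"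
    "\<And>\<epsilon>. \<epsilon> > 0 \<Longrightarrow> D2 \<epsilon> = (\<Sum>(\<mu>, m)\<in>S2. c2 (\<mu>, m) * of_real \<epsilon> powr (- \<mu>) * of_real (ln \<epsilon>) ^ m)"
    by (rule diverging_partE[OF assms(2)]) (rule that)
  define c where "c = (\<lambda>s. (if s \<in> S1 then c1 s else 0) + (if s \<in> S2 then c2 s else 0))"
  have "D1 \<epsilon> + D2 \<epsilon> = (\<Sum>(\<mu>, m)\<in>S1 \<union> S2. c (\<mu>, m) * of_real \<epsilon> powr (- \<mu>) * of_real (ln \<epsilon>) ^ m)"
    if "\<epsilon> > 0" for \<epsilon>
  proof -
    have "D1 \<epsilon> = (\<Sum>s\<in>S1 \<union> S2. (if s \<in> S1 then c1 s else 0) * ?e \<epsilon> s)"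
      unfolding S1(3)[OF that] using S1(1) S2(1)
      by (intro sum.mono_neutral_cong_left) (auto simp: case_prod_beta mult.assoc)
    moreover have "D2 \<epsilon> = (\<Sum>s\<in>S1 \<union> S2. (if s \<in> S2 then c2 s else 0) * ?e \<epsilon> s)"
      unfolding S2(3)[OF that] using S1(1) S2(1)
      by (intro sum.mono_neutral_cong_left) (auto simp: case_prod_beta mult.assoc)
    ultimately show ?thesis
      unfolding c_def case_prod_eta sum.distrib[symmetric]
      by (simp only: sum.distrib[symmetric]) (intro sum.cong refl; auto simp: algebra_simps)
  qed
  moreover have "\<forall>(\<mu>, m)\<in>S1 \<union> S2. Re \<mu> \<ge> 0 \<and> (\<mu>, m) \<noteq> (0, 0)"
    using S1(2) S2(2) by fast
  ultimately show ?thesis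
    unfolding diverging_part_def using S1(1) S2(1) by (intro exI[of _ "S1 \<union> S2"] exI[of _ c]) auto
qed

lemma diverging_part_sum:
  assumes "finite I" "\<And>i. i \<in> I \<Longrightarrow> diverging_part (D i)"
  shows "diverging_part (\<lambda>\<epsilon>. \<Sum>i\<in>I. D i \<epsilon>)"
  using assms by (induction I) (auto intro: diverging_part_0 diverging_part_add)

lemma diverging_part_powr_poly:
  assumes "Re \<mu> \<ge> 0" "\<mu> \<noteq> 0"
  shows "diverging_part (\<lambda>\<epsilon>. of_real \<epsilon> powr (- \<mu>) * poly p (of_real (ln \<epsilon>)))"
  unfolding diverging_part_def
proof (intro exI conjI allI impI)
  let ?S = "{\<mu>} \<times> {..degree p}"
  let ?c = "\<lambda>s :: complex \<times> nat. coeff p (snd s)"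
  show "finite ?S" "\<forall>(\<mu>, m)\<in>?S. Re \<mu> \<ge> 0 \<and> (\<mu>, m) \<noteq> (0, 0)"
    using assms by auto
  fix \<epsilon> :: real
  show "of_real \<epsilon> powr (- \<mu>) * poly p (of_real (ln \<epsilon>)) =
      (\<Sum>(\<mu>, m)\<in>?S. ?c (\<mu>, m) * of_real \<epsilon> powr (- \<mu>) * of_real (ln \<epsilon>) ^ m)"
    by (simp add: sum.cartesian_product[symmetric] poly_altdef sum_distrib_left mult_ac)
qed

section \<open>Taylor splitting and the asymptotics of the vertical side\<close>

text \<open>Taylor coefficients at 0 are peeled off one at a time; each quotient (h z - h 0) / z has
  a removable singularity, so the remainder is holomorphic on all of S and not merely on a
  disc.\<close>

lemma holomorphic_power_remainder:
  assumes "open S" "0 \<in> S" "f holomorphic_on S"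
  obtains c h where "h holomorphic_on S"
    "\<And>z. z \<in> S \<Longrightarrow> f z = (\<Sum>m<N. c m * z ^ m) + z ^ N * h z"
proof -
  have "\<exists>c h. h holomorphic_on S \<and> (\<forall>z\<in>S. f z = (\<Sum>m<N. c m * z ^ m) + z ^ N * h z)"
  proof (induction N)
    case 0
    then show ?case using assms by (intro exI[of _ undefined] exI[of _ f]) auto
  next
    case (Suc N)
    then obtain c h where h: "h holomorphic_on S"
      "\<And>z. z \<in> S \<Longrightarrow> f z = (\<Sum>m<N. c m * z ^ m) + z ^ N * h z" by blast
    define g where "g = (\<lambda>z. if z = 0 then deriv h 0 else (h z - h 0) / (z - 0))"
    have "g holomorphic_on S"
      unfolding g_def by (rule pole_lemma_open[OF h(1) assms(1)])
    moreover have hg: "h z = h 0 + z * g z" for z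
      by (simp add: g_def)
    have "f z = (\<Sum>m<Suc N. (c(N := h 0)) m * z ^ m) + z ^ Suc N * g z" if "z \<in> S" for z
    proof -
      have "f z = (\<Sum>m<N. c m * z ^ m) + z ^ N * (h 0 + z * g z)"
        using h(2)[OF that] hg[of z] by simp
      then show ?thesis by (simp add: algebra_simps)
    qed
    ultimately show ?case by blast
  qed
  then show thesis using that by blast
qed

text \<open>The equation says that e^{sw} R(w) is a primitive of e^{sw} P(w). If R solves it for the
  derivative of P, then (P - R) / s solves it for P.\<close>

lemma poly_ode_solution:
  fixes s :: complex
  assumes "s \<noteq> 0"
  shows "\<exists>R. pderiv R + smult s R = P"
proof (induction "degree P" arbitrary: P rule: less_induct)
  case less
  show ?case
  proof (cases "degree P = 0")
    case True
    then obtain c where "P = [:c:]" using degree_eq_zeroE by blast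
    then show ?thesis using assms by (intro exI[of _ "[:c / s:]"]) simp
  next
    case False
    then have "degree (pderiv P) < degree P" by (simp add: degree_pderiv)
    from less[OF this] obtain R where R: "pderiv R + smult s R = pderiv P" by blast
    have "pderiv (smult (1 / s) (P - R)) + smult s (smult (1 / s) (P - R)) =
        smult (1 / s) (pderiv P - pderiv R - smult s R) + P"
      using assms by (simp add: pderiv_smult pderiv_diff smult_diff_right)
    also have "pderiv P - pderiv R - smult s R = 0" using R by (simp add: algebra_simps)
    finally have "pderiv (smult (1 / s) (P - R)) + smult s (smult (1 / s) (P - R)) = P" by simp
    then show ?thesis by (rule exI)
  qed
qed

text \<open>The same q serves every x, so at x = ln eps the value is eps^s times a fixed polynomial
  in ln eps, the shape of a diverging part.\<close>

lemma contour_integral_vertical_exp_poly: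
  fixes s :: complex and p :: "complex poly"
  assumes "s \<noteq> 0"
  shows "\<exists>q. \<forall>x. ((\<lambda>w. exp (s * w) * poly p w) has_contour_integral exp (s * x) * poly q x)
    (linepath x (x + 2 * pi * \<i>))"
proof -
  let ?T = "2 * complex_of_real pi * \<i>"
  obtain R where R: "pderiv R + smult s R = p" using poly_ode_solution[OF assms] by blast
  define q where "q = smult (exp (s * ?T)) (pshift ?T R) - R"
  have "((\<lambda>w. exp (s * w) * poly p w) has_contour_integral exp (s * x) * poly q x)
    (linepath x (x + 2 * pi * \<i>))" for x
  proof -
    have "((\<lambda>w. exp (s * w) * poly R w) has_field_derivative exp (s * w) * poly p w) (at w within UNIV)" for w
      unfolding R[symmetric] by (auto intro!: derivative_eq_intros simp: algebra_simps)
    from contour_integral_primitive[OF this, of "linepath x (x + ?T)"]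
    have "((\<lambda>w. exp (s * w) * poly p w) has_contour_integral
        (exp (s * (x + ?T)) * poly R (x + ?T) - exp (s * x) * poly R x)) (linepath x (x + ?T))"
      by simp
    then show ?thesis by (simp add: q_def algebra_simps exp_add)
  qed
  then show ?thesis by blast
qed

lemma tendsto_powr_times_abs_ln_power:
  assumes "\<sigma> > 0"
  shows "((\<lambda>\<epsilon>::real. exp (\<sigma> * ln \<epsilon>) * (\<bar>ln \<epsilon>\<bar> + c) ^ i) \<longlongrightarrow> 0) (at_right 0)"
proof -
  have lim: "filterlim (\<lambda>\<epsilon>::real. \<sigma> * (- ln \<epsilon> + c)) at_top (at_right 0)"
  proof -
    have "filterlim (\<lambda>\<epsilon>::real. c + - ln \<epsilon>) at_top (at_right 0)"
      by (intro filterlim_tendsto_add_at_top[OF tendsto_const]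
          filterlim_compose[OF filterlim_uminus_at_top_at_bot ln_at_0])
    then show ?thesis
      using assms filterlim_tendsto_pos_mult_at_top[OF tendsto_const] by (simp add: add.commute)
  qed
  \<comment> \<open>In the variable u = sigma (c - ln eps), which tends to infinity, the function is
    a constant times u^i / e^u.\<close>
  have "((\<lambda>\<epsilon>. exp (\<sigma> * c) / \<sigma> ^ i * ((\<sigma> * (- ln \<epsilon> + c)) ^ i / exp (\<sigma> * (- ln \<epsilon> + c)))) \<longlongrightarrow>
      exp (\<sigma> * c) / \<sigma> ^ i * 0) (at_right 0)"
    by (intro tendsto_intros filterlim_compose[OF tendsto_power_div_exp_0 lim])
  moreover have "\<forall>\<^sub>F \<epsilon>::real in at_right 0. \<epsilon> \<in> {0<..<1}"
    by (rule eventually_at_right_real) simp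
  then have "\<forall>\<^sub>F \<epsilon> in at_right 0. exp (\<sigma> * c) / \<sigma> ^ i * ((\<sigma> * (- ln \<epsilon> + c)) ^ i / exp (\<sigma> * (- ln \<epsilon> + c))) =
      exp (\<sigma> * ln \<epsilon>) * (\<bar>ln \<epsilon>\<bar> + c) ^ i"
  proof eventually_elim
    case (elim \<epsilon>)
    then have "\<bar>ln \<epsilon>\<bar> = - ln \<epsilon>" by (simp add: ln_less_zero)
    moreover have "exp (\<sigma> * (- ln \<epsilon> + c)) = exp (\<sigma> * c) / exp (\<sigma> * ln \<epsilon>)"
      by (simp add: algebra_simps flip: exp_diff)
    ultimately show ?case
      using assms by (simp add: power_mult_distrib)
  qed
  ultimately show ?thesis by (simp add: Lim_transform_eventually)
qed

text \<open>On a side of fixed length 2 pi the exponential is of size eps^{Re s} up to a constant, h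
  is bounded near 0, and the polynomial grows only like a power of |ln eps|.\<close>

lemma vertical_remainder_tendsto_0:
  fixes s :: complex
  assumes "Re s > 0" "open U" "0 \<in> U" "h holomorphic_on U"
  shows "((\<lambda>\<epsilon>. contour_integral (linepath (of_real (ln \<epsilon>)) (of_real (ln \<epsilon>) + 2 * pi * \<i>))
    (\<lambda>w. exp (s * w) * h (exp w) * poly p w)) \<longlongrightarrow> 0) (at_right 0)"
proof -
  have "isCont h 0"
    using assms(2-4) by (meson continuous_on_eq_continuous_at holomorphic_on_imp_continuous_on)
  then obtain d where d: "d > 0" "\<And>z. dist z 0 < d \<Longrightarrow> dist (h z) (h 0) < 1"
    unfolding continuous_at_eps_delta by (metis zero_less_one)
  obtain e where e: "e > 0" "ball 0 e \<subseteq> U" using assms(2,3) open_contains_ball by blast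
  define r where "r = min 1 (min d e)"
  have r: "r > 0" "ball 0 r \<subseteq> U" using d e by (auto simp: r_def)
  define B where "B = norm (h 0) + 1"
  have B: "B \<ge> 0" "norm (h z) \<le> B" if "norm z < r" for z
    using d(2)[of z] that norm_triangle_sub[of "h z" "h 0"] by (auto simp: r_def B_def dist_norm)
  define M where "M = (\<lambda>\<epsilon>. exp (Re s * ln \<epsilon>) * exp (\<bar>Im s\<bar> * (2 * pi)) * B *
    (\<Sum>i\<le>degree p. norm (coeff p i) * (\<bar>ln \<epsilon>\<bar> + 2 * pi) ^ i))"
  have bound: "norm (contour_integral (linepath (of_real (ln \<epsilon>)) (of_real (ln \<epsilon>) + 2 * pi * \<i>))
    (\<lambda>w. exp (s * w) * h (exp w) * poly p w)) \<le> M \<epsilon> * (2 * pi)" if \<epsilon>: "\<epsilon> \<in> {0<..<r}" for \<epsilon>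
  proof -
    let ?F = "\<lambda>w. exp (s * w) * h (exp w) * poly p w"
    let ?a = "complex_of_real (ln \<epsilon>)"
    have seg: "Re w = ln \<epsilon>" "0 \<le> Im w" "Im w \<le> 2 * pi" if "w \<in> closed_segment ?a (?a + 2 * pi * \<i>)" for w
      using that by (auto simp: closed_segment_same_Re closed_segment_eq_real_ivl)
    have "path_image (linepath ?a (?a + 2 * pi * \<i>)) \<subseteq> {w. exp w \<in> U}"
    proof
      fix w assume "w \<in> path_image (linepath ?a (?a + 2 * pi * \<i>))"
      then have "exp w \<in> ball 0 r" using seg(1)[of w] \<epsilon> by simp
      then show "w \<in> {w. exp w \<in> U}" using r by blast
    qed
    moreover have "open {w. exp w \<in> U}"
      using open_vimage[OF assms(2), of exp] by (simp add: vimage_def continuous_on_exp)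
    moreover have "?F holomorphic_on {w. exp w \<in> U}"
      by (intro holomorphic_intros holomorphic_on_compose_gen[OF _ assms(4), unfolded o_def]) auto
    ultimately have int: "?F contour_integrable_on linepath ?a (?a + 2 * pi * \<i>)"
      by (intro contour_integrable_holomorphic_simple) auto
    have "norm (?F w) \<le> M \<epsilon>" if w: "w \<in> closed_segment ?a (?a + 2 * pi * \<i>)" for w
    proof -
      have "- (Im s * Im w) \<le> \<bar>Im s\<bar> * (2 * pi)"
        using seg[OF w] by (metis abs_ge_minus_self abs_mult abs_of_nonneg abs_ge_zero mult_left_mono order_trans)
      then have "norm (exp (s * w)) \<le> exp (Re s * ln \<epsilon>) * exp (\<bar>Im s\<bar> * (2 * pi))"
        using seg[OF w] by (simp flip: exp_add)
      moreover have "norm (h (exp w)) \<le> B"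
        using seg[OF w] \<epsilon> by (intro B) simp
      moreover have "norm (poly p w) \<le> (\<Sum>i\<le>degree p. norm (coeff p i) * (\<bar>ln \<epsilon>\<bar> + 2 * pi) ^ i)"
      proof -
        have "norm w \<le> \<bar>ln \<epsilon>\<bar> + 2 * pi"
          using cmod_le[of w] seg[OF w] by simp
        then have "norm (coeff p i * w ^ i) \<le> norm (coeff p i) * (\<bar>ln \<epsilon>\<bar> + 2 * pi) ^ i" for i
          by (simp add: norm_mult norm_power mult_left_mono power_mono)
        then show ?thesis unfolding poly_altdef by (intro sum_norm_le)
      qed
      ultimately show ?thesis
        unfolding norm_mult M_def using B(1)[of 0] r(1) by (intro mult_mono mult_nonneg_nonneg) auto
    qed
    moreover have "0 \<le> M \<epsilon>"
      unfolding M_def using B(1)[of 0] r(1) by (intro mult_nonneg_nonneg sum_nonneg) auto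
    ultimately have "norm (contour_integral (linepath ?a (?a + 2 * pi * \<i>)) ?F) \<le>
        M \<epsilon> * norm (?a + 2 * pi * \<i> - ?a)"
      by (intro contour_integral_bound_linepath int)
    then show ?thesis by (simp add: norm_mult)
  qed
  have "M = (\<lambda>\<epsilon>. \<Sum>i\<le>degree p. exp (\<bar>Im s\<bar> * (2 * pi)) * B * norm (coeff p i) *
      (exp (Re s * ln \<epsilon>) * (\<bar>ln \<epsilon>\<bar> + 2 * pi) ^ i))"
    by (simp add: M_def sum_distrib_left mult_ac)
  moreover have "(\<dots> \<longlongrightarrow> (\<Sum>i\<le>degree p. exp (\<bar>Im s\<bar> * (2 * pi)) * B * norm (coeff p i) * 0)) (at_right 0)"
    by (intro tendsto_intros tendsto_powr_times_abs_ln_power assms)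
  ultimately have "(M \<longlongrightarrow> 0) (at_right 0)" by simp
  then have "((\<lambda>\<epsilon>. M \<epsilon> * (2 * pi)) \<longlongrightarrow> 0) (at_right 0)"
    using tendsto_mult_left_zero by blast
  then show ?thesis
    by (rule Lim_null_comparison[rotated])
      (use eventually_at_right_real[OF r(1)] bound in \<open>auto elim!: eventually_mono\<close>)
qed

lemma vertical_integral_asymptotics:
  fixes lam :: complex and p :: "complex poly"
  assumes "lam \<notin> \<int>" "open U" "0 \<in> U" "k holomorphic_on U"
  defines "V \<equiv> \<lambda>\<epsilon>. contour_integral (linepath (of_real (ln \<epsilon>)) (of_real (ln \<epsilon>) + 2 * pi * \<i>))
    (\<lambda>w. k (exp w) * exp ((1 - lam) * w) * poly p w)"
  obtains D where "diverging_part D" "((\<lambda>\<epsilon>. V \<epsilon> + D \<epsilon>) \<longlongrightarrow> 0) (at_right 0)"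
proof -
  \<comment> \<open>For m < N the exponent m + 1 - lam has real part at most 0, so the term is
    diverging or oscillating; the remainder exponent N + 1 - lam has positive real part, also when
    \<open>nat\<close> truncates a negative floor to 0.\<close>
  define N where "N = nat \<lfloor>Re lam\<rfloor>"
  obtain c h where h: "h holomorphic_on U"
    "\<And>z. z \<in> U \<Longrightarrow> k z = (\<Sum>m<N. c m * z ^ m) + z ^ N * h z"
    using holomorphic_power_remainder[OF assms(2-4)] by metis
  define s where "s = (\<lambda>m::nat. of_nat m + 1 - lam)"
  have s0: "s m \<noteq> 0" for m
  proof
    assume "s m = 0"
    then have "lam = of_nat (m + 1)"
      unfolding s_def by (metis eq_iff_diff_eq_0 of_nat_1 of_nat_add)
    then show False using assms(1) Ints_of_nat by metis
  qed
  have "\<forall>m. \<exists>q. \<forall>x. ((\<lambda>w. exp (s m * w) * poly p w) has_contour_integral exp (s m * x) * poly q x)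
    (linepath x (x + 2 * pi * \<i>))"
    using contour_integral_vertical_exp_poly[OF s0] by blast
  then obtain q where q: "\<And>m x. ((\<lambda>w. exp (s m * w) * poly p w) has_contour_integral exp (s m * x) * poly (q m) x)
    (linepath x (x + 2 * pi * \<i>))" by metis
  \<comment> \<open>D is minus the Taylor contribution, so V + D is exactly the remainder integral;
    the double negation exhibits the exponent as -mu with mu = \<open>- s m\<close>.\<close>
  define D where "D = (\<lambda>\<epsilon>. \<Sum>m<N. of_real \<epsilon> powr (- (- s m)) * poly (smult (- c m) (q m)) (of_real (ln \<epsilon>)))"
  have "diverging_part D"
    unfolding D_def
  proof (intro diverging_part_sum diverging_part_powr_poly)
    fix m assume "m \<in> {..<N}"
    then have "int m + 1 \<le> \<lfloor>Re lam\<rfloor>" by (auto simp: N_def)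
    then have "real m + 1 \<le> Re lam" by (simp add: le_floor_iff)
    then show "0 \<le> Re (- s m)" by (simp add: s_def)
    show "- s m \<noteq> 0" using s0 by simp
  qed simp
  obtain r where r: "r > 0" "ball 0 r \<subseteq> U" using assms(2,3) open_contains_ball by blast
  define E where "E = (\<lambda>\<epsilon>. contour_integral (linepath (of_real (ln \<epsilon>)) (of_real (ln \<epsilon>) + 2 * pi * \<i>))
    (\<lambda>w. exp (s N * w) * h (exp w) * poly p w))"
  have "Re (s N) > 0"
    unfolding s_def N_def by simp linarith
  then have "(E \<longlongrightarrow> 0) (at_right 0)"
    unfolding E_def by (intro vertical_remainder_tendsto_0[OF _ assms(2,3) h(1)])
  moreover have "E \<epsilon> = V \<epsilon> + D \<epsilon>" if \<epsilon>: "\<epsilon> \<in> {0<..<r}" for \<epsilon>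
  proof -
    let ?p = "linepath (complex_of_real (ln \<epsilon>)) (of_real (ln \<epsilon>) + 2 * pi * \<i>)"
    let ?F = "\<lambda>w. exp (s N * w) * h (exp w) * poly p w"
    have inU: "exp w \<in> U" if "w \<in> path_image ?p" for w
    proof -
      have "Re w = ln \<epsilon>" using that by (auto simp: closed_segment_same_Re)
      then have "exp w \<in> ball 0 r" using \<epsilon> by simp
      then show ?thesis using r by blast
    qed
    have "open {w. exp w \<in> U}"
      using open_vimage[OF assms(2), of exp] by (simp add: vimage_def continuous_on_exp)
    moreover have "?F holomorphic_on {w. exp w \<in> U}"
      by (intro holomorphic_intros holomorphic_on_compose_gen[OF _ h(1), unfolded o_def]) auto
    ultimately have int: "?F contour_integrable_on ?p"
      using inU by (intro contour_integrable_holomorphic_simple) auto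
    have "((\<lambda>w. (\<Sum>m<N. c m * (exp (s m * w) * poly p w)) + ?F w) has_contour_integral
        ((\<Sum>m<N. c m * (exp (s m * of_real (ln \<epsilon>)) * poly (q m) (of_real (ln \<epsilon>)))) + E \<epsilon>)) ?p"
      unfolding E_def
      by (intro has_contour_integral_add has_contour_integral_sum has_contour_integral_lmul q
          has_contour_integral_integral int) simp
    moreover have "(\<Sum>m<N. c m * (exp (s m * of_real (ln \<epsilon>)) * poly (q m) (of_real (ln \<epsilon>)))) = - D \<epsilon>"
      using \<epsilon> by (simp add: D_def powr_def Ln_of_real sum_negf mult_ac)
    moreover have "(\<Sum>m<N. c m * (exp (s m * w) * poly p w)) + ?F w = k (exp w) * exp ((1 - lam) * w) * poly p w"
      if "w \<in> path_image ?p" for w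
    proof -
      have "exp (s m * w) = exp w ^ m * exp ((1 - lam) * w)" for m
        by (simp add: s_def exp_of_nat_mult[symmetric] exp_add[symmetric] algebra_simps)
      then show ?thesis
        unfolding h(2)[OF inU[OF that]] by (simp add: distrib_left distrib_right sum_distrib_right sum_distrib_left mult_ac)
    qed
    ultimately have "((\<lambda>w. k (exp w) * exp ((1 - lam) * w) * poly p w) has_contour_integral (- D \<epsilon> + E \<epsilon>)) ?p"
      using has_contour_integral_eq by (metis (no_types, lifting))
    then show ?thesis unfolding V_def by (simp add: contour_integral_unique)
  qed
  ultimately have "((\<lambda>\<epsilon>. V \<epsilon> + D \<epsilon>) \<longlongrightarrow> 0) (at_right 0)"
    using eventually_at_right_real[OF r(1)] by (elim Lim_transform_eventually) (auto elim!: eventually_mono)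
  then show thesis using that \<open>diverging_part D\<close> by blast
qed

subsection \<open>The finite part\<close>

text \<open>Substitute t = e^x: the factor 1/t from dx = dt/t turns e^{(1 - lam) x} into t^{-lam},
  and on positive reals \<open>powr\<close> uses the real logarithm.\<close>

lemma has_integral_log_substitution:
  assumes "0 < \<epsilon>" "\<epsilon> < a" "continuous_on (complex_of_real ` {\<epsilon>..a}) k"
  shows "((\<lambda>t. k (of_real t) * of_real (ln t) ^ n / of_real t powr lam) has_integral
    contour_integral (linepath (of_real (ln \<epsilon>)) (of_real (ln a)))
      (\<lambda>w. k (exp w) * exp ((1 - lam) * w) * w ^ n)) {\<epsilon>..a}"
proof -
  let ?G = "\<lambda>w. k (exp w) * exp ((1 - lam) * w) * w ^ n"
  have lt: "ln \<epsilon> < ln a" using assms by simp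
  have "continuous_on {ln \<epsilon>..ln a} (\<lambda>x. k (exp (complex_of_real x)))"
  proof (rule continuous_on_compose2[OF assms(3)])
    show "(\<lambda>x. exp (complex_of_real x)) ` {ln \<epsilon>..ln a} \<subseteq> complex_of_real ` {\<epsilon>..a}"
    proof
      fix z assume "z \<in> (\<lambda>x. exp (complex_of_real x)) ` {ln \<epsilon>..ln a}"
      then obtain x where x: "ln \<epsilon> \<le> x" "x \<le> ln a" "z = of_real (exp x)"
        by (auto simp: exp_of_real)
      have "exp (ln \<epsilon>) \<le> exp x" "exp x \<le> exp (ln a)" using x by simp_all
      then show "z \<in> complex_of_real ` {\<epsilon>..a}" using x assms by auto
    qed
  qed (intro continuous_intros)
  then have "((\<lambda>t. (1 / t) *\<^sub>R ?G (of_real (ln t))) has_integral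
      integral {ln \<epsilon>..ln a} (\<lambda>x. ?G (of_real x))) {\<epsilon>..a}"
    using assms lt
    by (intro has_integral_substitution[where c = "ln \<epsilon>" and d = "ln a"])
      (auto intro!: continuous_intros derivative_eq_intros)
  also have "integral {ln \<epsilon>..ln a} (\<lambda>x. ?G (of_real x)) =
      contour_integral (linepath (of_real (ln \<epsilon>)) (of_real (ln a))) ?G"
    using lt by (subst contour_integral_linepath_Reals_eq) auto
  finally show ?thesis
  proof (rule has_integral_eq[rotated])
    fix t assume "t \<in> {\<epsilon>..a}"
    then have t: "t > 0" using assms by auto
    have "exp (complex_of_real (ln t)) = of_real t" using t by (simp add: exp_of_real)
    then show "(1 / t) *\<^sub>R ?G (of_real (ln t)) = k (of_real t) * of_real (ln t) ^ n / of_real t powr lam"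
      using t by (simp add: left_diff_distrib exp_diff powr_def Ln_of_real scaleR_conv_of_real)
  qed
qed

lemma exp_eq_1_imp_Ints:
  assumes "exp (- 2 * pi * \<i> * lam) = 1"
  shows "lam \<in> \<int>"
proof -
  obtain n :: int where n: "- 2 * pi * \<i> * lam = 0 + (of_int (2 * n) * pi) * \<i>"
    using assms exp_eq[of "- 2 * pi * \<i> * lam" 0] by auto
  have "(2 * pi * \<i>) * (lam + of_int n) = (of_int (2 * n) * pi) * \<i> - (- 2 * pi * \<i> * lam)"
    by (simp add: algebra_simps)
  also have "\<dots> = 0" unfolding n by simp
  finally have "lam = of_int (- n)"
    by (simp add: add_eq_0_iff2)
  then show ?thesis by (metis Ints_of_int)
qed

lemma open_analytic_set:
  fixes k :: "complex \<Rightarrow> complex"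
  shows "open {z. k analytic_on {z}}"
proof (rule Topological_Spaces.openI)
  fix z :: complex assume "z \<in> {z. k analytic_on {z}}"
  then obtain S where "open S" "z \<in> S" "k holomorphic_on S"
    by (auto simp: analytic_at)
  then show "\<exists>T. open T \<and> z \<in> T \<and> T \<subseteq> {z. k analytic_on {z}}"
    by (intro exI[of _ S]) (auto simp: analytic_at)
qed

theorem theorem3p1:
  fixes a :: real and k :: "complex \<Rightarrow> complex" and n :: nat and lam :: complex
    and C :: "real \<Rightarrow> complex"
  assumes "0 < a"
    and "k analytic_on (complex_of_real ` {0..a})"
    and "k 0 \<noteq> 0"
    and "n \<ge> 1"
    and "lam \<notin> \<int>"
    and "Re lam \<ge> 1"
    and "cut_contour k a C"
  shows "has_finite_part_integral
           (\<lambda>t. k (of_real t) * of_real (ln t) ^ n / of_real t powr lam)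
           (\<Sum>j=0..n. of_nat (n choose j) * (2 * pi * \<i>) ^ (n - j) * beta_coeff n j lam *
              contour_integral C (\<lambda>z. k z / powr_cut z lam * ln_cut z ^ j))
           a" (is "has_finite_part_integral ?f ?I a")
proof -
  obtain g where g: "valid_path g" "pathstart g = of_real (ln a)"
    "pathfinish g = of_real (ln a) + 2 * pi * \<i>"
    and Cg: "\<And>t. t \<in> {0..1} \<Longrightarrow> C t = exp (g t)"
    and strip: "\<And>t. t \<in> {0<..<1} \<Longrightarrow> 0 < Im (g t) \<and> Im (g t) < 2 * pi"
    using cut_contour_logarithm[OF assms(1,7)] by blast
  \<comment> \<open>With the full analyticity set as U, the contour conditions become: the path lies
    in U and has winding number 0 around every point outside U.\<close>
  define U where "U = {z. k analytic_on {z}}"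
  have U: "open U" unfolding U_def by (rule open_analytic_set)
  have kU: "k holomorphic_on U"
    using analytic_on_analytic_at[of k U] by (intro analytic_imp_holomorphic) (simp add: U_def)
  have aU: "complex_of_real ` {0..a} \<subseteq> U"
    using assms(2) by (auto simp: U_def analytic_on_analytic_at[of k "complex_of_real ` {0..a}"])
  then have U0: "0 \<in> U" using \<open>0 < a\<close> by force
  obtain r where r: "r > 0" "ball 0 r \<subseteq> U" using U U0 open_contains_ball by blast
  have pathC: "path_image (exp \<circ> g) = path_image C"
    using Cg by (auto simp: path_image_def)
  have windC: "winding_number (exp \<circ> g) z = winding_number C z" for z
    by (rule winding_number_cong) (use Cg in auto)
  have CU: "path_image (exp \<circ> g) \<subseteq> U"
    using assms(7) by (auto simp: pathC U_def cut_contour_def)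
  have wind: "winding_number (exp \<circ> g) z = 0" if "z \<notin> U" for z
    using assms(7) that CU by (auto simp: windC pathC U_def cut_contour_def)
  define \<Omega> where "\<Omega> = {w. exp w \<in> U}"
  have \<Omega>: "open \<Omega>"
    using open_vimage[OF U, of exp] by (simp add: \<Omega>_def vimage_def continuous_on_exp)
  have g\<Omega>: "path_image g \<subseteq> \<Omega>" using CU by (auto simp: \<Omega>_def path_image_compose)
  have hol: "(\<lambda>w. k (exp w) * exp ((1 - lam) * w) * w ^ j) holomorphic_on \<Omega>" for j
    unfolding \<Omega>_def by (intro holomorphic_intros holomorphic_on_compose_gen[OF _ kU, unfolded o_def]) auto
  let ?P = "beta_poly n lam"
  define \<Phi> where "\<Phi> = (\<lambda>w. k (exp w) * exp ((1 - lam) * w) * poly ?P w)"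
  have \<Phi>hol: "\<Phi> holomorphic_on {w. exp w \<in> U}"
    unfolding \<Phi>_def by (intro holomorphic_intros holomorphic_on_compose_gen[OF _ kU, unfolded o_def]) auto
  have term_j: "contour_integral C (\<lambda>z. k z / powr_cut z lam * ln_cut z ^ j) =
      contour_integral g (\<lambda>w. k (exp w) * exp ((1 - lam) * w) * w ^ j)" for j
    by (rule contour_integral_exp_cut[OF g(1) Cg strip])
  have I: "?I = contour_integral g \<Phi>"
  proof -
    have "((\<lambda>w. \<Sum>j=0..n. of_nat (n choose j) * (2 * pi * \<i>) ^ (n - j) * beta_coeff n j lam *
        (k (exp w) * exp ((1 - lam) * w) * w ^ j)) has_contour_integral ?I) g"
      unfolding term_j
      by (intro has_contour_integral_sum has_contour_integral_lmul has_contour_integral_integral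
          contour_integrable_holomorphic_simple[OF hol \<Omega> g(1) g\<Omega>]) simp
    then have "?I = contour_integral g (\<lambda>w. \<Sum>j=0..n. of_nat (n choose j) * (2 * pi * \<i>) ^ (n - j) *
        beta_coeff n j lam * (k (exp w) * exp ((1 - lam) * w) * w ^ j))"
      by (simp add: contour_integral_unique)
    also have "(\<lambda>w. \<Sum>j=0..n. of_nat (n choose j) * (2 * pi * \<i>) ^ (n - j) *
        beta_coeff n j lam * (k (exp w) * exp ((1 - lam) * w) * w ^ j)) = \<Phi>"
      by (simp add: \<Phi>_def beta_poly_def poly_sum poly_monom sum_distrib_left atMost_atLeast0 mult_ac)
    finally show ?thesis .
  qed
  have q: "exp (- 2 * pi * \<i> * lam) \<noteq> 1"
    using exp_eq_1_imp_Ints assms(5) by blast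
  \<comment> \<open>The shift by 2 pi i multiplies the exponential by e^{-2 pi i lam} and leaves
    k(e^w) unchanged; \<open>beta_poly_monodromy\<close> then gives w^n.\<close>
  have jump: "\<Phi> (w + 2 * pi * \<i>) - \<Phi> w = k (exp w) * exp ((1 - lam) * w) * w ^ n" for w
  proof -
    have "exp ((1 - lam) * (w + 2 * pi * \<i>)) = exp ((1 - lam) * w + - 2 * pi * \<i> * lam + 2 * pi * \<i>)"
      by (simp add: algebra_simps)
    also have "\<dots> = exp ((1 - lam) * w) * exp (- 2 * pi * \<i> * lam)"
      by (simp only: exp_add) simp
    finally have e: "exp ((1 - lam) * (w + 2 * pi * \<i>)) = exp ((1 - lam) * w) * exp (- 2 * pi * \<i> * lam)" .
    have "exp (w + 2 * pi * \<i>) = exp w" by (simp add: exp_add)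
    then have "\<Phi> (w + 2 * pi * \<i>) - \<Phi> w = k (exp w) * exp ((1 - lam) * w) *
        (exp (- 2 * pi * \<i> * lam) * poly ?P (w + 2 * pi * \<i>) - poly ?P w)"
      unfolding \<Phi>_def e by (simp only: right_diff_distrib mult.assoc)
    then show ?thesis unfolding beta_poly_monodromy[OF q] .
  qed
  define J where "J = (\<lambda>\<epsilon>. contour_integral (linepath (of_real (ln \<epsilon>)) (of_real (ln a)))
    (\<lambda>w. k (exp w) * exp ((1 - lam) * w) * w ^ n))"
  define V where "V = (\<lambda>\<epsilon>. contour_integral (linepath (of_real (ln \<epsilon>)) (of_real (ln \<epsilon>) + 2 * pi * \<i>)) \<Phi>)"
  have J: "(?f has_integral J \<epsilon>) {\<epsilon>..a}" if "0 < \<epsilon>" "\<epsilon> < a" for \<epsilon>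
    unfolding J_def using that aU
    by (intro has_integral_log_substitution continuous_on_subset[OF holomorphic_on_imp_continuous_on[OF kU]])
      auto
  have IJV: "?I = J \<epsilon> + V \<epsilon>" if "\<epsilon> \<in> {0<..<min a r}" for \<epsilon>
    unfolding I J_def V_def jump[symmetric]
    by (rule contour_integral_logarithm[OF g strip U CU wind aU r(2) _ _ _ \<Phi>hol]) (use that in auto)
  obtain D where D: "diverging_part D" "((\<lambda>\<epsilon>. V \<epsilon> + D \<epsilon>) \<longlongrightarrow> 0) (at_right 0)"
    unfolding V_def \<Phi>_def
    by (rule vertical_integral_asymptotics[OF assms(5) U U0 kU, of ?P]) (rule that[unfolded V_def \<Phi>_def])
  \<comment> \<open>The left side is J - D by \<open>IJV\<close>, so J - D is the convergent part
    and D the diverging part of J.\<close>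
  have "((\<lambda>\<epsilon>. ?I - (V \<epsilon> + D \<epsilon>)) \<longlongrightarrow> ?I - 0) (at_right 0)"
    by (intro tendsto_intros D)
  moreover have "\<forall>\<^sub>F \<epsilon> in at_right 0. ?I - (V \<epsilon> + D \<epsilon>) = J \<epsilon> - D \<epsilon>"
  proof -
    have "\<forall>\<^sub>F \<epsilon>::real in at_right 0. \<epsilon> \<in> {0<..<min a r}"
      using r \<open>0 < a\<close> by (intro eventually_at_right_real) simp
    then show ?thesis by eventually_elim (use IJV in \<open>simp add: algebra_simps\<close>)
  qed
  ultimately have "((\<lambda>\<epsilon>. J \<epsilon> - D \<epsilon>) \<longlongrightarrow> ?I) (at_right 0)"
    by (simp add: Lim_transform_eventually)
  then show ?thesis
    unfolding has_finite_part_integral_def using J D(1)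
    by (intro exI[of _ "\<lambda>\<epsilon>. J \<epsilon> - D \<epsilon>"] exI[of _ D]) auto
qed

end
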